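(* Let $k$ be an algebraically closed field and $n\geq1$. For every weight $a=(a_0,\ldots,a_n)$ of positive integers there is a well-formed weight $a'=(a_0',\ldots,a_n')$ such that $\mathbb{P}(a_0,\ldots,a_n)\cong\mathbb{P}(a_0',\ldots,a_n')$. That is, any weighted projective space is isomorphic to a well-formed weighted projective space.
   Context: $\mathbb{P}(a_0,\ldots,a_n)=\operatorname{Proj}k_a[x_0,\ldots,x_n]$, where $k_a[x_0,\ldots,x_n]$ is the polynomial ring graded by $\deg x_i=a_i$; isomorphism means isomorphism of algebraic varieties (schemes) over $k$. A weight $a=(a_0,\ldots,a_n)$ is well-formed if for every $0\leq i\leq n$ the greatest common divisor of the $n$ integers $a_j$ with $j\neq i$ equals $1$; $\mathbb{P}(a_0,\ldots,a_n)$ is well-formed if its weight is. *)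

theory Defs
  imports
    "HOL-Analysis.Abstract_Topology"
    "HOL-Library.Poly_Mapping"
    "HOL-Computational_Algebra.Polynomial"
    "HOL-Computational_Algebra.Fraction_Field"
    "HOL-Algebra.RingHom"
begin

section \<open>Ringed spaces over a field\<close>

text \<open>
  The components are: the topology, the ring of sections over an open set, the restriction map
  from a larger open set to a smaller one, and the structure map from the base field \<open>k\<close> to the
  sections over an open set.  Only the values at open sets matter.
\<close>

record ('p, 's, 'k) ringed_space =
  space_top :: "'p topology"
  sections :: "'p set \<Rightarrow> 's ring"
  res :: "'p set \<Rightarrow> 'p set \<Rightarrow> 's \<Rightarrow> 's"
  scalar :: "'p set \<Rightarrow> 'k \<Rightarrow> 's"

definition points :: "('p, 's, 'k) ringed_space \<Rightarrow> 'p set" where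
  "points X = topspace (space_top X)"

definition preimg ::
  "('p, 's, 'k) ringed_space \<Rightarrow> ('p \<Rightarrow> 'q) \<Rightarrow> 'q set \<Rightarrow> 'p set" where
  "preimg X f V = {x \<in> points X. f x \<in> V}"

text \<open>The germ at \<open>x\<close> of the section \<open>s\<close> over \<open>U\<close> is a unit of the stalk at \<open>x\<close>.\<close>

definition germ_unit ::
  "('p, 's, 'k) ringed_space \<Rightarrow> 'p set \<Rightarrow> 'p \<Rightarrow> 's \<Rightarrow> bool" where
  "germ_unit X U x s \<longleftrightarrow>
     (\<exists>W. openin (space_top X) W \<and> x \<in> W \<and> W \<subseteq> U \<and> res X U W s \<in> Units (sections X W))"

text \<open>
  Morphisms of locally ringed spaces over \<open>k\<close>.  Here \<open>\<phi> V\<close> is the comorphism from the sections of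
  \<open>Y\<close> over \<open>V\<close> to the sections of \<open>X\<close> over the preimage of \<open>V\<close>.  The last condition says that the
  induced maps of stalks are local homomorphisms, i.e. reflect units.
\<close>

definition ringed_morphism ::
  "('p, 's, 'k) ringed_space \<Rightarrow> ('q, 't, 'k) ringed_space \<Rightarrow>
   ('p \<Rightarrow> 'q) \<Rightarrow> ('q set \<Rightarrow> 't \<Rightarrow> 's) \<Rightarrow> bool" where
  "ringed_morphism X Y f \<phi> \<longleftrightarrow>
     continuous_map (space_top X) (space_top Y) f \<and>
     (\<forall>V. openin (space_top Y) V \<longrightarrow>
        \<phi> V \<in> ring_hom (sections Y V) (sections X (preimg X f V))) \<and>
     (\<forall>V W. openin (space_top Y) V \<longrightarrow> openin (space_top Y) W \<longrightarrow> W \<subseteq> V \<longrightarrow>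
        (\<forall>s \<in> carrier (sections Y V).
           \<phi> W (res Y V W s) = res X (preimg X f V) (preimg X f W) (\<phi> V s))) \<and>
     (\<forall>V. openin (space_top Y) V \<longrightarrow>
        (\<forall>c. \<phi> V (scalar Y V c) = scalar X (preimg X f V) c)) \<and>
     (\<forall>V. openin (space_top Y) V \<longrightarrow>
        (\<forall>s \<in> carrier (sections Y V). \<forall>x \<in> preimg X f V.
           germ_unit X (preimg X f V) x (\<phi> V s) \<longrightarrow> germ_unit Y V (f x) s))"

text \<open>
  For open \<open>U\<close> in \<open>X\<close>, \<open>preimg X f (preimg Y g U) = U\<close> as soon as \<open>g \<circ> f\<close> is the identity, so the
  last two conditions say that both composites are the identity on structure sheaves.
\<close>

definition ringed_isomorphic ::
  "('p, 's, 'k) ringed_space \<Rightarrow> ('q, 't, 'k) ringed_space \<Rightarrow> bool" where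
  "ringed_isomorphic X Y \<longleftrightarrow>
     (\<exists>f \<phi> g \<gamma>.
        ringed_morphism X Y f \<phi> \<and> ringed_morphism Y X g \<gamma> \<and>
        (\<forall>x \<in> points X. g (f x) = x) \<and> (\<forall>y \<in> points Y. f (g y) = y) \<and>
        (\<forall>U. openin (space_top X) U \<longrightarrow>
           (\<forall>s \<in> carrier (sections X U). \<phi> (preimg Y g U) (\<gamma> U s) = s)) \<and>
        (\<forall>V. openin (space_top Y) V \<longrightarrow>
           (\<forall>t \<in> carrier (sections Y V). \<gamma> (preimg X f V) (\<phi> V t) = t)))"


section \<open>Proj of a graded domain\<close>

text \<open>
  A graded domain is given as a subring \<open>A\<close> of a type of class \<^class>\<open>idom\<close>, together with its
  homogeneous pieces \<open>G d\<close>.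
\<close>

definition ring_on :: "'a::comm_ring_1 set \<Rightarrow> 'a ring" where
  "ring_on A = \<lparr>carrier = A, mult = (*), one = 1, zero = 0, add = (+)\<rparr>"

locale graded_domain =
  fixes A :: "'a::idom set" and G :: "nat \<Rightarrow> 'a set"
  assumes cring_A: "cring (ring_on A)"
    and piece_subgroup: "0 \<in> G d" "\<lbrakk>x \<in> G d; y \<in> G d\<rbrakk> \<Longrightarrow> x - y \<in> G d"
    and piece_subset: "G d \<subseteq> A"
    and one_piece: "1 \<in> G 0"
    and mult_piece: "\<lbrakk>x \<in> G d; y \<in> G e\<rbrakk> \<Longrightarrow> x * y \<in> G (d + e)"
    and decomp: "x \<in> A \<Longrightarrow> \<exists>D g. finite D \<and> (\<forall>d \<in> D. g d \<in> G d) \<and> x = (\<Sum>d\<in>D. g d)"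
    and decomp_unique:
      "\<lbrakk>finite D; \<forall>d \<in> D. g d \<in> G d; (\<Sum>d\<in>D. g d) = 0; d \<in> D\<rbrakk> \<Longrightarrow> g d = 0"

definition irrelevant_ideal :: "(nat \<Rightarrow> 'a::comm_ring_1 set) \<Rightarrow> 'a set" where
  "irrelevant_ideal G =
     {\<Sum>d\<in>D. g d | D g. finite D \<and> 0 \<notin> D \<and> (\<forall>d \<in> D. g d \<in> G d)}"

text \<open>The set contains the homogeneous components of each of its elements.\<close>

definition homogeneous_set :: "(nat \<Rightarrow> 'a::comm_ring_1 set) \<Rightarrow> 'a set \<Rightarrow> bool" where
  "homogeneous_set G I \<longleftrightarrow>
     (\<forall>D g. finite D \<longrightarrow> (\<forall>d \<in> D. g d \<in> G d) \<longrightarrow> (\<Sum>d\<in>D. g d) \<in> I \<longrightarrow> (\<forall>d \<in> D. g d \<in> I))"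

definition Proj_points :: "'a::idom set \<Rightarrow> (nat \<Rightarrow> 'a set) \<Rightarrow> 'a set set" where
  "Proj_points A G =
     {P. primeideal P (ring_on A) \<and> homogeneous_set G P \<and> \<not> irrelevant_ideal G \<subseteq> P}"

definition Vplus :: "'a::idom set \<Rightarrow> (nat \<Rightarrow> 'a set) \<Rightarrow> 'a set \<Rightarrow> 'a set set" where
  "Vplus A G E = {P \<in> Proj_points A G. E \<subseteq> P}"

text \<open>
  The closed sets are the \<open>Vplus A G I\<close> for homogeneous ideals \<open>I\<close>; equivalently \<open>E\<close> runs through
  sets of homogeneous elements, generators of such ideals.
\<close>

definition Proj_open :: "'a::idom set \<Rightarrow> (nat \<Rightarrow> 'a set) \<Rightarrow> 'a set set \<Rightarrow> bool" where
  "Proj_open A G U \<longleftrightarrow> (\<exists>E. E \<subseteq> (\<Union>d. G d) \<and> U = Proj_points A G - Vplus A G E)"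

definition Proj_top :: "'a::idom set \<Rightarrow> (nat \<Rightarrow> 'a set) \<Rightarrow> 'a set topology" where
  "Proj_top A G = topology (Proj_open A G)"

text \<open>
  The homogeneous localization at \<open>P\<close>, i.e. the degree \<open>0\<close> part of the localization at the
  homogeneous elements outside \<open>P\<close>, as a subring of the field of fractions of the domain.
\<close>

definition hom_localization :: "(nat \<Rightarrow> 'a::idom set) \<Rightarrow> 'a set \<Rightarrow> 'a fract set" where
  "hom_localization G P = {Fract b h | b h d. b \<in> G d \<and> h \<in> G d \<and> h \<notin> P}"

definition Proj_sections ::
  "'a::idom set \<Rightarrow> (nat \<Rightarrow> 'a set) \<Rightarrow> 'a set set \<Rightarrow> ('a set \<Rightarrow> 'a fract) set" where
  "Proj_sections A G U =
     {s \<in> PiE U (hom_localization G).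
        \<forall>P \<in> U. \<exists>V. openin (Proj_top A G) V \<and> P \<in> V \<and> V \<subseteq> U \<and>
          (\<exists>d b h. b \<in> G d \<and> h \<in> G d \<and> (\<forall>Q \<in> V. h \<notin> Q \<and> s Q = Fract b h))}"

text \<open>\<open>\<iota>\<close> is the structure map from the base field to the degree \<open>0\<close> piece.\<close>

definition Proj ::
  "'a::idom set \<Rightarrow> (nat \<Rightarrow> 'a set) \<Rightarrow> ('k \<Rightarrow> 'a) \<Rightarrow> ('a set, 'a set \<Rightarrow> 'a fract, 'k) ringed_space"
  where
  "Proj A G \<iota> =
     \<lparr>space_top = Proj_top A G,
      sections = (\<lambda>U. \<lparr>carrier = Proj_sections A G U,
                       mult = (\<lambda>s t. \<lambda>P\<in>U. s P * t P),
                       one = (\<lambda>P\<in>U. 1),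
                       zero = (\<lambda>P\<in>U. 0),
                       add = (\<lambda>s t. \<lambda>P\<in>U. s P + t P)\<rparr>),
      res = (\<lambda>U V s. restrict s V),
      scalar = (\<lambda>U c. \<lambda>P\<in>U. Fract (\<iota> c) 1)\<rparr>"

context graded_domain
begin

lemma istopology_Proj_open: "istopology (Proj_open A G)"
  unfolding istopology_def
proof (intro conjI allI impI)
  fix S T assume "Proj_open A G S" "Proj_open A G T"
  then obtain E F where EF: "E \<subseteq> (\<Union>d. G d)" "F \<subseteq> (\<Union>d. G d)"
      "S = Proj_points A G - Vplus A G E" "T = Proj_points A G - Vplus A G F"
    unfolding Proj_open_def by auto
  define H where "H = {e * f | e f. e \<in> E \<and> f \<in> F}"
  have "H \<subseteq> (\<Union>d. G d)"
  proof
    fix x assume "x \<in> H"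
    then obtain e f d d' where "x = e * f" "e \<in> G d" "f \<in> G d'"
      using EF(1,2) unfolding H_def by blast
    then show "x \<in> (\<Union>d. G d)" using mult_piece by blast
  qed
  moreover have "H \<subseteq> P \<longleftrightarrow> E \<subseteq> P \<or> F \<subseteq> P" if "P \<in> Proj_points A G" for P
  proof -
    interpret primeideal P "ring_on A" using that by (simp add: Proj_points_def)
    have EA: "E \<subseteq> A" "F \<subseteq> A" using EF piece_subset by blast+
    have pr: "e \<in> P \<or> f \<in> P" if "e \<in> A" "f \<in> A" "e * f \<in> P" for e f
      using I_prime[of e f] that by (simp add: ring_on_def)
    have l: "e * f \<in> P" if "e \<in> P" "f \<in> A" for e f
      using I_r_closed[of e f] that by (simp add: ring_on_def)
    have r: "e * f \<in> P" if "e \<in> A" "f \<in> P" for e f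
      using I_l_closed[of f e] that by (simp add: ring_on_def)
    show ?thesis
      unfolding H_def using EA pr l r by blast
  qed
  then have "S \<inter> T = Proj_points A G - Vplus A G H"
    unfolding EF Vplus_def by blast
  ultimately show "Proj_open A G (S \<inter> T)"
    unfolding Proj_open_def by blast
next
  fix \<K> assume "\<forall>K \<in> \<K>. Proj_open A G K"
  then obtain e where e: "\<And>K. K \<in> \<K> \<Longrightarrow>
      e K \<subseteq> (\<Union>d. G d) \<and> K = Proj_points A G - Vplus A G (e K)"
    unfolding Proj_open_def by metis
  have "\<Union>\<K> = (\<Union>K\<in>\<K>. K)" by simp
  also have "\<dots> = (\<Union>K\<in>\<K>. Proj_points A G - Vplus A G (e K))"
    by (rule SUP_cong) (use e in auto)
  also have "\<dots> = Proj_points A G - Vplus A G (\<Union>K\<in>\<K>. e K)"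
    unfolding Vplus_def by blast
  finally show "Proj_open A G (\<Union>\<K>)"
    unfolding Proj_open_def using e by (intro exI[of _ "\<Union>K\<in>\<K>. e K"]) blast
qed

lemma openin_Proj_top: "openin (Proj_top A G) U \<longleftrightarrow> Proj_open A G U"
  unfolding Proj_top_def by (simp add: istopology_Proj_open topology_inverse')

lemma topspace_Proj_top: "topspace (Proj_top A G) = Proj_points A G"
proof -
  have "False" if P: "P \<in> Proj_points A G" and sub: "(\<Union>d. G d) \<subseteq> P" for P
  proof -
    interpret primeideal P "ring_on A" using P by (simp add: Proj_points_def)
    have "1 \<in> P" using sub one_piece by blast
    then have "P = A" using one_imp_carrier by (simp add: ring_on_def)
    then show False using I_notcarr by (simp add: ring_on_def)
  qed
  then have "Proj_open A G (Proj_points A G)"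
    unfolding Proj_open_def Vplus_def by (intro exI[of _ "\<Union>d. G d"]) auto
  moreover have "U \<subseteq> Proj_points A G" if "Proj_open A G U" for U
    using that by (auto simp: Proj_open_def)
  ultimately show ?thesis
    unfolding topspace_def openin_Proj_top by blast
qed

end


section \<open>Weighted projective spaces\<close>

type_synonym 'k mpoly = "(nat \<Rightarrow>\<^sub>0 nat) \<Rightarrow>\<^sub>0 'k"

text \<open>
  A weight \<open>(a\<^sub>0, \<dots>, a\<^sub>n)\<close> is a function on natural numbers of which only the values
  at \<open>0, \<dots>, n\<close> are used.
\<close>

definition positive_weight :: "nat \<Rightarrow> (nat \<Rightarrow> nat) \<Rightarrow> bool" where
  "positive_weight n a \<longleftrightarrow> (\<forall>i\<le>n. 0 < a i)"

definition well_formed_weight :: "nat \<Rightarrow> (nat \<Rightarrow> nat) \<Rightarrow> bool" where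
  "well_formed_weight n a \<longleftrightarrow> (\<forall>i\<le>n. Gcd {a j | j. j \<le> n \<and> j \<noteq> i} = 1)"

definition poly_ring :: "nat \<Rightarrow> 'k::field mpoly set" where
  "poly_ring n = {p. \<forall>m \<in> Poly_Mapping.keys p. Poly_Mapping.keys m \<subseteq> {..n}}"

definition weighted_degree :: "nat \<Rightarrow> (nat \<Rightarrow> nat) \<Rightarrow> (nat \<Rightarrow>\<^sub>0 nat) \<Rightarrow> nat" where
  "weighted_degree n a m = (\<Sum>i\<le>n. a i * Poly_Mapping.lookup m i)"

definition weighted_piece :: "nat \<Rightarrow> (nat \<Rightarrow> nat) \<Rightarrow> nat \<Rightarrow> 'k::field mpoly set" where
  "weighted_piece n a d = {p \<in> poly_ring n. \<forall>m \<in> Poly_Mapping.keys p. weighted_degree n a m = d}"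

definition weighted_projective_space ::
  "'k::field itself \<Rightarrow> nat \<Rightarrow> (nat \<Rightarrow> nat) \<Rightarrow>
   ('k mpoly set, 'k mpoly set \<Rightarrow> 'k mpoly fract, 'k) ringed_space" where
  "weighted_projective_space _ n a =
     Proj (poly_ring n) (weighted_piece n a) (\<lambda>c. Poly_Mapping.single 0 c)"

lemma weighted_degree_add:
  "weighted_degree n a (l + m) = weighted_degree n a l + weighted_degree n a m"
  by (simp add: weighted_degree_def lookup_add algebra_simps sum.distrib)

lemma poly_ring_closed:
  assumes "p \<in> poly_ring n" "q \<in> poly_ring n"
  shows "p + q \<in> poly_ring n" "p - q \<in> poly_ring n" "p * q \<in> poly_ring n"
proof -
  show "p + q \<in> poly_ring n"
    using assms keys_add[of p q] unfolding poly_ring_def by blast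
  show "p - q \<in> poly_ring n"
    using assms keys_diff[of p q] unfolding poly_ring_def by blast
  have "Poly_Mapping.keys m \<subseteq> {..n}" if m: "m \<in> Poly_Mapping.keys (p * q)" for m
  proof -
    obtain u v where "u \<in> Poly_Mapping.keys p" "v \<in> Poly_Mapping.keys q" "m = u + v"
      using keys_mult[of p q] m by blast
    then show ?thesis
      using assms keys_add[of u v] unfolding poly_ring_def by blast
  qed
  then show "p * q \<in> poly_ring n" unfolding poly_ring_def by blast
qed

lemma cring_poly_ring: "cring (ring_on (poly_ring n :: 'k::field mpoly set))"
proof (rule cringI)
  have z: "(0 :: 'k mpoly) \<in> poly_ring n" by (simp add: poly_ring_def)
  have o: "(1 :: 'k mpoly) \<in> poly_ring n"
    by (simp add: poly_ring_def)
  show "abelian_group (ring_on (poly_ring n :: 'k mpoly set))"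
  proof (rule abelian_groupI)
    fix x :: "'k mpoly" assume x: "x \<in> carrier (ring_on (poly_ring n))"
    show "\<exists>y\<in>carrier (ring_on (poly_ring n)). y \<oplus>\<^bsub>ring_on (poly_ring n)\<^esub> x = \<zero>\<^bsub>ring_on (poly_ring n)\<^esub>"
      using x z poly_ring_closed(2)[OF z, of x]
      by (intro bexI[of _ "- x"]) (auto simp: ring_on_def)
  qed (use z in \<open>auto simp: ring_on_def poly_ring_closed algebra_simps\<close>)
  show "Group.comm_monoid (ring_on (poly_ring n :: 'k mpoly set))"
    by (rule Group.comm_monoidI) (use o in \<open>auto simp: ring_on_def poly_ring_closed algebra_simps\<close>)
qed (auto simp: ring_on_def algebra_simps)

lemma graded_domain_weighted:
  "graded_domain (poly_ring n :: 'k::field mpoly set) (weighted_piece n a)"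
proof (rule graded_domain.intro)
  show "cring (ring_on (poly_ring n :: 'k mpoly set))" by (rule cring_poly_ring)
next
  fix d show "(0 :: 'k mpoly) \<in> weighted_piece n a d"
    by (simp add: weighted_piece_def poly_ring_def)
next
  fix d and x y :: "'k mpoly"
  assume "x \<in> weighted_piece n a d" "y \<in> weighted_piece n a d"
  then show "x - y \<in> weighted_piece n a d"
    using keys_diff[of x y] unfolding weighted_piece_def by (auto simp: poly_ring_closed)
next
  fix d show "(weighted_piece n a d :: 'k mpoly set) \<subseteq> poly_ring n"
    by (auto simp: weighted_piece_def)
next
  show "(1 :: 'k mpoly) \<in> weighted_piece n a 0"
    by (simp add: weighted_piece_def poly_ring_def weighted_degree_def)
next
  fix d e and x y :: "'k mpoly"
  assume "x \<in> weighted_piece n a d" "y \<in> weighted_piece n a e"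
  then show "x * y \<in> weighted_piece n a (d + e)"
    using keys_mult[of x y] unfolding weighted_piece_def
    by (fastforce simp: poly_ring_closed weighted_degree_add)
next
  fix x :: "'k mpoly" assume x: "x \<in> poly_ring n"
  define K where "K d = {m \<in> Poly_Mapping.keys x. weighted_degree n a m = d}" for d
  define g where "g d = (\<Sum>m\<in>K d. Poly_Mapping.single m (Poly_Mapping.lookup x m))" for d
  define D where "D = weighted_degree n a ` Poly_Mapping.keys x"
  have "Poly_Mapping.keys (g d) \<subseteq> K d" for d
  proof -
    have "Poly_Mapping.keys (g d) \<subseteq> (\<Union>m\<in>K d. Poly_Mapping.keys (Poly_Mapping.single m (Poly_Mapping.lookup x m)))"
      unfolding g_def by (rule keys_sum)
    then show ?thesis by (auto split: if_splits)
  qed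
  then have g: "g d \<in> weighted_piece n a d" for d
    using x unfolding weighted_piece_def poly_ring_def K_def by blast
  have "(\<Sum>d\<in>D. g d) = (\<Sum>m\<in>Poly_Mapping.keys x. Poly_Mapping.single m (Poly_Mapping.lookup x m))"
    unfolding D_def g_def K_def by (rule sum.image_gen[symmetric]) simp
  also have "\<dots> = x"
  proof (rule poly_mapping_eqI)
    fix m
    show "Poly_Mapping.lookup (\<Sum>m\<in>Poly_Mapping.keys x. Poly_Mapping.single m (Poly_Mapping.lookup x m)) m
        = Poly_Mapping.lookup x m"
      by (simp add: lookup_sum lookup_single when_def in_keys_iff)
  qed
  finally show "\<exists>D g. finite D \<and> (\<forall>d\<in>D. g d \<in> weighted_piece n a d) \<and> x = (\<Sum>d\<in>D. g d)"
    using g by (intro exI[of _ D] exI[of _ g]) (auto simp: D_def)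
next
  fix D d and g :: "nat \<Rightarrow> 'k mpoly"
  assume D: "finite D" "\<forall>d\<in>D. g d \<in> weighted_piece n a d" "(\<Sum>d\<in>D. g d) = 0" "d \<in> D"
  show "g d = 0"
  proof (rule poly_mapping_eqI)
    fix m
    show "Poly_Mapping.lookup (g d) m = Poly_Mapping.lookup 0 m"
    proof (cases "m \<in> Poly_Mapping.keys (g d)")
      case True
      have *: "Poly_Mapping.lookup (g e) m = 0" if "e \<in> D" "e \<noteq> d" for e
      proof (rule ccontr)
        assume "Poly_Mapping.lookup (g e) m \<noteq> 0"
        then have "m \<in> Poly_Mapping.keys (g e)" by (simp add: in_keys_iff)
        moreover have "g e \<in> weighted_piece n a e" "g d \<in> weighted_piece n a d"
          using D that by auto
        ultimately have "weighted_degree n a m = e" "weighted_degree n a m = d"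
          using True unfolding weighted_piece_def by blast+
        then show False using \<open>e \<noteq> d\<close> by simp
      qed
      have "0 = (\<Sum>e\<in>D. Poly_Mapping.lookup (g e) m)"
        using D(3) by (metis lookup_sum lookup_zero)
      also have "\<dots> = Poly_Mapping.lookup (g d) m"
        using D * by (subst sum.remove[of _ d]) auto
      finally show ?thesis by simp
    qed (simp add: in_keys_iff)
  qed
qed

end

theory Submission
  imports Defs
begin

text \<open>
  If a graded domain \<open>B\<close> is isomorphic to the \<open>N\<close>-th Veronese subring of \<open>A\<close>, then \<open>Proj A\<close> and
  \<open>Proj B\<close> are isomorphic: a homogeneous prime \<open>Q\<close> of \<open>B\<close> corresponds to the prime whose homogeneous
  elements are the \<open>x\<close> with \<open>x ^ N \<in> Q\<close>, and a fraction \<open>b / h\<close> equals \<open>b * h ^ (N - 1) / h ^ N\<close>.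
  Given a weight \<open>a\<close>, let \<open>g\<close> be the gcd of all entries, \<open>b = a / g\<close>, \<open>d i\<close> the gcd of the \<open>b j\<close> with
  \<open>j \<noteq> i\<close>, and \<open>D\<close> the product of the \<open>d i\<close>, which are pairwise coprime.  A monomial has degree
  divisible by \<open>g * D\<close> only if its exponent at each \<open>x\<^sub>i\<close> is divisible by \<open>d i\<close>, so the \<open>g * D\<close>-th
  Veronese subring is the polynomial ring in the powers \<open>x\<^sub>i ^ d i\<close>, with weight
  \<open>a' i = b i * d i / D\<close>, and this weight is well-formed.
\<close>

section \<open>Isomorphisms of ringed spaces\<close>

lemma Units_ring_hom:
  assumes "h \<in> ring_hom R S" "s \<in> Units R"
  shows "h s \<in> Units S"
proof -
  obtain t where t: "t \<in> carrier R" "s \<in> carrier R" "t \<otimes>\<^bsub>R\<^esub> s = \<one>\<^bsub>R\<^esub>" "s \<otimes>\<^bsub>R\<^esub> t = \<one>\<^bsub>R\<^esub>"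
    using assms(2) unfolding Units_def by blast
  have "h t \<otimes>\<^bsub>S\<^esub> h s = \<one>\<^bsub>S\<^esub>" "h s \<otimes>\<^bsub>S\<^esub> h t = \<one>\<^bsub>S\<^esub>"
    using t assms(1) by (metis ring_hom_mult ring_hom_one)+
  then show ?thesis
    unfolding Units_def using ring_hom_closed[OF assms(1)] t by blast
qed

text \<open>Everything in the definition of a morphism except that stalk maps are local.\<close>

definition presheaf_morphism ::
  "('p, 's, 'k) ringed_space \<Rightarrow> ('q, 't, 'k) ringed_space \<Rightarrow>
   ('p \<Rightarrow> 'q) \<Rightarrow> ('q set \<Rightarrow> 't \<Rightarrow> 's) \<Rightarrow> bool" where
  "presheaf_morphism X Y f \<phi> \<longleftrightarrow>
     continuous_map (space_top X) (space_top Y) f \<and>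
     (\<forall>V. openin (space_top Y) V \<longrightarrow>
        \<phi> V \<in> ring_hom (sections Y V) (sections X (preimg X f V))) \<and>
     (\<forall>V W. openin (space_top Y) V \<longrightarrow> openin (space_top Y) W \<longrightarrow> W \<subseteq> V \<longrightarrow>
        (\<forall>s \<in> carrier (sections Y V).
           \<phi> W (res Y V W s) = res X (preimg X f V) (preimg X f W) (\<phi> V s))) \<and>
     (\<forall>V. openin (space_top Y) V \<longrightarrow>
        (\<forall>c. \<phi> V (scalar Y V c) = scalar X (preimg X f V) c))"

lemma openin_preimg:
  assumes "continuous_map (space_top X) (space_top Y) f" "openin (space_top Y) V"
  shows "openin (space_top X) (preimg X f V)"
  using openin_continuous_map_preimage[OF assms] by (simp add: preimg_def points_def)

lemma preimg_preimg:
  assumes "continuous_map (space_top Y) (space_top X) g"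
    and "\<And>y. y \<in> points Y \<Longrightarrow> f (g y) = y" "V \<subseteq> points Y"
  shows "preimg Y g (preimg X f V) = V"
  using assms continuous_map_image_subset_topspace[OF assms(1)]
  by (fastforce simp: preimg_def points_def)

text \<open>If \<open>\<phi> V s\<close> becomes a unit on some \<open>W\<close> around
  \<open>x\<close>, the ring homomorphism \<open>\<gamma> W\<close> carries that unit to the
  restriction of \<open>s\<close> to the preimage of \<open>W\<close>, a neighbourhood of
  \<open>f x\<close>. So locality of the stalk maps is automatic.\<close>

lemma ringed_morphism_of_inverses:
  assumes f: "presheaf_morphism X Y f \<phi>" and g: "presheaf_morphism Y X g \<gamma>"
    and gf: "\<And>x. x \<in> points X \<Longrightarrow> g (f x) = x" and fg: "\<And>y. y \<in> points Y \<Longrightarrow> f (g y) = y"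
    and inv: "\<And>V t. \<lbrakk>openin (space_top Y) V; t \<in> carrier (sections Y V)\<rbrakk> \<Longrightarrow>
      \<gamma> (preimg X f V) (\<phi> V t) = t"
  shows "ringed_morphism X Y f \<phi>"
proof -
  have cf: "continuous_map (space_top X) (space_top Y) f"
    and cg: "continuous_map (space_top Y) (space_top X) g"
    using f g by (auto simp: presheaf_morphism_def)
  have "germ_unit Y V (f x) s"
    if V: "openin (space_top Y) V" and s: "s \<in> carrier (sections Y V)"
      and x: "x \<in> preimg X f V" and u: "germ_unit X (preimg X f V) x (\<phi> V s)" for V s x
  proof -
    let ?U = "preimg X f V"
    obtain W where W: "openin (space_top X) W" "x \<in> W" "W \<subseteq> ?U"
        and unit: "res X ?U W (\<phi> V s) \<in> Units (sections X W)"
      using u unfolding germ_unit_def by blast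
    have U: "openin (space_top X) ?U" using openin_preimg[OF cf V] .
    have V_eq: "preimg Y g ?U = V"
      using V fg by (intro preimg_preimg[OF cg]) (auto simp: points_def dest: openin_subset)
    have W': "openin (space_top Y) (preimg Y g W)" using openin_preimg[OF cg W(1)] .
    have "\<phi> V \<in> ring_hom (sections Y V) (sections X ?U)"
      using f V by (simp add: presheaf_morphism_def)
    then have \<phi>s: "\<phi> V s \<in> carrier (sections X ?U)" using s by (rule ring_hom_closed)
    have "\<gamma> W \<in> ring_hom (sections X W) (sections Y (preimg Y g W))"
      using g W by (simp add: presheaf_morphism_def)
    then have "\<gamma> W (res X ?U W (\<phi> V s)) \<in> Units (sections Y (preimg Y g W))"
      using unit by (rule Units_ring_hom)
    \<comment> \<open>Naturality of \<open>\<gamma>\<close> for \<open>W \<subseteq> ?U\<close>;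
      \<open>V_eq\<close> turns sections over \<open>preimg Y g ?U\<close> into sections over
      \<open>V\<close>.\<close>
    also have "\<gamma> W (res X ?U W (\<phi> V s)) = res Y V (preimg Y g W) (\<gamma> ?U (\<phi> V s))"
      using g U W \<phi>s V_eq by (simp add: presheaf_morphism_def)
    also have "\<gamma> ?U (\<phi> V s) = s" using inv V s .
    finally have "res Y V (preimg Y g W) s \<in> Units (sections Y (preimg Y g W))" .
    moreover have "x \<in> points X" using x by (simp add: preimg_def)
    then have "f x \<in> preimg Y g W"
      using W cf gf continuous_map_image_subset_topspace[OF cf] by (auto simp: preimg_def points_def)
    moreover have "preimg Y g W \<subseteq> V"
      using W(3) V_eq by (auto simp: preimg_def)
    ultimately show ?thesis unfolding germ_unit_def using W' by blast
  qed
  then show ?thesis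
    using f unfolding ringed_morphism_def presheaf_morphism_def by simp
qed

lemma ringed_isomorphicI:
  assumes "presheaf_morphism X Y f \<phi>" "presheaf_morphism Y X g \<gamma>"
    and "\<And>x. x \<in> points X \<Longrightarrow> g (f x) = x" "\<And>y. y \<in> points Y \<Longrightarrow> f (g y) = y"
    and "\<And>U s. \<lbrakk>openin (space_top X) U; s \<in> carrier (sections X U)\<rbrakk> \<Longrightarrow>
      \<phi> (preimg Y g U) (\<gamma> U s) = s"
    and "\<And>V t. \<lbrakk>openin (space_top Y) V; t \<in> carrier (sections Y V)\<rbrakk> \<Longrightarrow>
      \<gamma> (preimg X f V) (\<phi> V t) = t"
  shows "ringed_isomorphic X Y"
  unfolding ringed_isomorphic_def
  using assms ringed_morphism_of_inverses[of X Y f \<phi> g \<gamma>] ringed_morphism_of_inverses[of Y X g \<gamma> f \<phi>]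
  by blast


section \<open>Homogeneous primes of graded domains\<close>

text \<open>Restates primality in the operations of the ambient type, so that later arguments can
  avoid the record operations of \<open>ring_on A\<close>.\<close>

lemma primeideal_ring_on_iff:
  fixes A :: "'a::comm_ring_1 set"
  assumes "cring (ring_on A)"
  shows "primeideal P (ring_on A) \<longleftrightarrow>
    P \<subseteq> A \<and> 0 \<in> P \<and> (\<forall>x\<in>P. \<forall>y\<in>P. x + y \<in> P) \<and> (\<forall>x\<in>A. \<forall>y\<in>P. x * y \<in> P) \<and> P \<noteq> A \<and>
    (\<forall>x\<in>A. \<forall>y\<in>A. x * y \<in> P \<longrightarrow> x \<in> P \<or> y \<in> P)" (is "_ \<longleftrightarrow> ?R")
proof
  assume "primeideal P (ring_on A)"
  then interpret primeideal P "ring_on A" .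
  show ?R
    using a_subset additive_subgroup.zero_closed[OF additive_subgroup_axioms]
      additive_subgroup.a_closed[OF additive_subgroup_axioms] I_l_closed I_notcarr I_prime
    by (auto simp: ring_on_def)
next
  assume R: ?R
  interpret cring "ring_on A" by fact
  have minus: "\<ominus>\<^bsub>ring_on A\<^esub> x = - x \<and> - x \<in> A" if "x \<in> A" for x
    using l_neg[of x] a_inv_closed[of x] that
    by (metis (no_types, lifting) eq_neg_iff_add_eq_0 partial_object.select_convs(1) ring.simps ring_on_def)
  have one: "1 \<in> A" using one_closed by (simp add: ring_on_def)
  show "primeideal P (ring_on A)"
  proof (rule primeidealI2)
    show "additive_subgroup P (ring_on A)"
    proof (intro additive_subgroupI subgroup.intro)
      fix x assume x: "x \<in> P"
      \<comment> \<open>Closure under negation is not listed in \<open>?R\<close>; it comes from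
        absorption of \<open>- 1\<close>.\<close>
      then have "- 1 * x \<in> P" using R minus[OF one] by blast
      then show "inv\<^bsub>add_monoid (ring_on A)\<^esub> x \<in> P"
        using minus[of x] x R unfolding a_inv_def by auto
    qed (use R in \<open>auto simp: ring_on_def\<close>)
    show "a \<otimes>\<^bsub>ring_on A\<^esub> x \<in> P" if "a \<in> P" "x \<in> carrier (ring_on A)" for a x
      using R that by (subst m_comm) (auto simp: ring_on_def)
  qed (use R assms in \<open>auto simp: ring_on_def\<close>)
qed

context graded_domain
begin

section \<open>Closure properties and homogeneous components\<close>

lemma A_closed: "0 \<in> A" "1 \<in> A" "\<lbrakk>x \<in> A; y \<in> A\<rbrakk> \<Longrightarrow> x + y \<in> A" "\<lbrakk>x \<in> A; y \<in> A\<rbrakk> \<Longrightarrow> x * y \<in> A"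
proof -
  interpret cring "ring_on A" by (rule cring_A)
  show "0 \<in> A" "1 \<in> A" "\<lbrakk>x \<in> A; y \<in> A\<rbrakk> \<Longrightarrow> x + y \<in> A" "\<lbrakk>x \<in> A; y \<in> A\<rbrakk> \<Longrightarrow> x * y \<in> A"
    using zero_closed one_closed add.m_closed[of x y] m_closed[of x y] by (simp_all add: ring_on_def)
qed

lemma piece_mem: "x \<in> G d \<Longrightarrow> x \<in> A"
  using piece_subset by blast

lemma piece_uminus: "x \<in> G d \<Longrightarrow> - x \<in> G d"
  using piece_subgroup(2)[of 0 d x] piece_subgroup(1) by simp

lemma piece_add: "\<lbrakk>x \<in> G d; y \<in> G d\<rbrakk> \<Longrightarrow> x + y \<in> G d"
  using piece_subgroup(2)[of x d "- y"] piece_uminus[of y d] by simp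

lemma piece_power: "x \<in> G d \<Longrightarrow> x ^ m \<in> G (m * d)"
  by (induction m) (auto simp: one_piece mult_piece)

lemma A_sum: "(\<And>i. i \<in> I \<Longrightarrow> f i \<in> A) \<Longrightarrow> sum f I \<in> A"
  by (induction I rule: infinite_finite_induct) (auto simp: A_closed)

text \<open>A decomposition may use any finite index set, padded with zero pieces; the value 0
  outside \<open>D\<close> makes the result independent of that choice, as
  \<open>component_sum\<close> shows.\<close>

definition component :: "nat \<Rightarrow> 'a \<Rightarrow> 'a" where
  "component d x = (THE y. \<exists>D g. finite D \<and> (\<forall>e\<in>D. g e \<in> G e) \<and> x = sum g D \<and>
     y = (if d \<in> D then g d else 0))"

lemma component_sum:
  assumes "finite D" "\<And>e. e \<in> D \<Longrightarrow> g e \<in> G e"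
  shows "component d (sum g D) = (if d \<in> D then g d else 0)"
  unfolding component_def
proof (rule the_equality)
  fix y assume "\<exists>D' g'. finite D' \<and> (\<forall>e\<in>D'. g' e \<in> G e) \<and> sum g D = sum g' D' \<and>
     y = (if d \<in> D' then g' d else 0)"
  then obtain D' g' where D': "finite D'" "\<And>e. e \<in> D' \<Longrightarrow> g' e \<in> G e" "sum g D = sum g' D'"
     and y: "y = (if d \<in> D' then g' d else 0)" by blast
  \<comment> \<open>Difference of the two decompositions, each extended by zero to
    \<open>D \<union> D'\<close>; it sums to 0, so \<open>decomp_unique\<close> makes every term
    vanish.\<close>
  define h where "h e = (if e \<in> D then g e else 0) - (if e \<in> D' then g' e else 0)" for e
  have "h e \<in> G e" for e
    unfolding h_def using assms D' by (intro piece_subgroup) (auto simp: piece_subgroup(1))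
  moreover have "sum h (D \<union> D') = 0"
    unfolding h_def sum_subtractf using assms(1) D'(1,3)
    by (simp add: sum.If_cases Int_absorb1 Int_absorb2)
  ultimately have "h d = 0" if "d \<in> D \<union> D'"
    using decomp_unique[of "D \<union> D'" h d] that assms(1) D'(1) by auto
  then show "y = (if d \<in> D then g d else 0)"
    unfolding y h_def by (auto split: if_splits)
qed (use assms in blast)

lemma decompE:
  assumes "x \<in> A"
  obtains D where "finite D" "x = (\<Sum>d\<in>D. component d x)" "\<And>d. d \<notin> D \<Longrightarrow> component d x = 0"
proof -
  obtain D g where D: "finite D" "\<And>d. d \<in> D \<Longrightarrow> g d \<in> G d" "x = sum g D"
    using decomp[OF assms] by blast
  have c: "component d x = (if d \<in> D then g d else 0)" for d
    unfolding D(3) using D by (intro component_sum) auto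
  then have "x = (\<Sum>d\<in>D. component d x)" using D(3) by simp
  then show thesis using D(1) c that by simp
qed

lemma component_piece: "x \<in> A \<Longrightarrow> component d x \<in> G d"
  using decomp[of x] component_sum[of _ _ d] piece_subgroup(1)[of d] by fastforce

lemma component_of_piece: "x \<in> G e \<Longrightarrow> component d x = (if d = e then x else 0)"
  using component_sum[of "{e}" "\<lambda>_. x" d] by simp

lemma component_add:
  assumes "x \<in> A" "y \<in> A"
  shows "component d (x + y) = component d x + component d y"
proof -
  obtain D where D: "finite D" "x = (\<Sum>d\<in>D. component d x)" "\<And>d. d \<notin> D \<Longrightarrow> component d x = 0"
    using decompE[OF assms(1)] by blast
  obtain E where E: "finite E" "y = (\<Sum>d\<in>E. component d y)" "\<And>d. d \<notin> E \<Longrightarrow> component d y = 0"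
    using decompE[OF assms(2)] by blast
  \<comment> \<open>Zero terms enlarge both sums to a common index set, so that they can be added
    termwise.\<close>
  have "x = (\<Sum>d\<in>D\<union>E. component d x)" "y = (\<Sum>d\<in>D\<union>E. component d y)"
    by (rule trans[OF D(2)] trans[OF E(2)], intro sum.mono_neutral_left; use D(1,3) E(1,3) in simp)+
  then have "x + y = (\<Sum>d\<in>D\<union>E. component d x) + (\<Sum>d\<in>D\<union>E. component d y)"
    by (rule arg_cong2)
  also have "\<dots> = (\<Sum>d\<in>D\<union>E. component d x + component d y)"
    by (rule sum.distrib[symmetric])
  also have "component d \<dots> = (if d \<in> D \<union> E then component d x + component d y else 0)"
    using D(1) E(1) assms by (intro component_sum) (auto simp: piece_add component_piece)
  finally show ?thesis using D(3) E(3) by auto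
qed

lemma component_sum_A:
  assumes "\<And>i. i \<in> I \<Longrightarrow> f i \<in> A"
  shows "component d (sum f I) = (\<Sum>i\<in>I. component d (f i))"
  using assms
proof (induction I rule: infinite_finite_induct)
  case (insert i I)
  then show ?case by (simp add: component_add A_sum)
qed (use component_of_piece[OF piece_subgroup(1)] in auto)

lemma component_mult_piece:
  assumes "x \<in> G i" "y \<in> A"
  shows "component d (x * y) = (if i \<le> d then x * component (d - i) y else 0)"
proof -
  obtain E where E: "finite E" "y = (\<Sum>e\<in>E. component e y)" "\<And>d. d \<notin> E \<Longrightarrow> component d y = 0"
    using decompE[OF assms(2)] by blast
  have m: "x * component e y \<in> G (i + e)" for e
    using assms by (intro mult_piece component_piece)
  have "component d (x * y) = component d (\<Sum>e\<in>E. x * component e y)"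
    using E(2) by (simp add: sum_distrib_left[symmetric])
  also have "\<dots> = (\<Sum>e\<in>E. component d (x * component e y))"
    using m piece_mem by (intro component_sum_A) blast
  also have "\<dots> = (\<Sum>e\<in>E. if d = i + e then x * component e y else 0)"
    using component_of_piece[OF m] by simp
  \<comment> \<open>The guard \<open>i \<le> d\<close> matters: for \<open>i > d\<close> the
    truncated difference \<open>d - i\<close> is 0 and would wrongly select degree 0.\<close>
  also have "\<dots> = (\<Sum>e\<in>E. if e = d - i then (if i \<le> d then x * component e y else 0) else 0)"
    by (intro sum.cong) auto
  finally show ?thesis using E by simp
qed

text \<open>The definition of \<open>homogeneous_set\<close> sees only the degrees of a given
  decomposition; \<open>0 \<in> P\<close> accounts for all other degrees, where the component is
  0.\<close>

lemma homogeneous_set_iff: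
  assumes "P \<subseteq> A"
  shows "homogeneous_set G P \<and> 0 \<in> P \<longleftrightarrow> (\<forall>x\<in>P. \<forall>d. component d x \<in> P) \<and> 0 \<in> P"
proof (intro iffI conjI ballI allI)
  fix x d assume P: "homogeneous_set G P \<and> 0 \<in> P" "x \<in> P"
  obtain D where "finite D" "x = (\<Sum>d\<in>D. component d x)" "\<And>d. d \<notin> D \<Longrightarrow> component d x = 0"
    using decompE[of x] P assms by blast
  then show "component d x \<in> P"
    using P component_piece assms unfolding homogeneous_set_def by (cases "d \<in> D") fastforce+
next
  assume P: "(\<forall>x\<in>P. \<forall>d. component d x \<in> P) \<and> 0 \<in> P"
  show "homogeneous_set G P"
    unfolding homogeneous_set_def
  proof (intro allI impI ballI)
    fix D g d assume D: "finite D" "\<forall>d\<in>D. g d \<in> G d" "sum g D \<in> P" "d \<in> D"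
    then have "component d (sum g D) = g d" by (subst component_sum) auto
    then show "g d \<in> P" using P D(3) by metis
  qed
qed auto

lemma irrelevant_ideal_subset_iff:
  assumes "0 \<in> P" "\<And>x y. \<lbrakk>x \<in> P; y \<in> P\<rbrakk> \<Longrightarrow> x + y \<in> P"
  shows "irrelevant_ideal G \<subseteq> P \<longleftrightarrow> (\<forall>d>0. G d \<subseteq> P)"
proof
  assume P: "irrelevant_ideal G \<subseteq> P"
  show "\<forall>d>0. G d \<subseteq> P"
  proof (intro allI impI subsetI)
    fix d :: nat and x assume "d > 0" "x \<in> G d"
    then have "x \<in> irrelevant_ideal G"
      unfolding irrelevant_ideal_def mem_Collect_eq
      by (intro exI[of _ "{d}"] exI[of _ "\<lambda>_. x"]) auto
    then show "x \<in> P" using P by blast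
  qed
next
  assume P: "\<forall>d>0. G d \<subseteq> P"
  have "sum g D \<in> P" if "finite D" "0 \<notin> D" "\<forall>d\<in>D. g d \<in> G d" for D g
    using that by (induction D) (use assms P in auto)
  then show "irrelevant_ideal G \<subseteq> P" unfolding irrelevant_ideal_def by blast
qed

section \<open>Points of Proj in terms of homogeneous components\<close>

lemma Proj_points_iff:
  "P \<in> Proj_points A G \<longleftrightarrow>
    P \<subseteq> A \<and> 0 \<in> P \<and> (\<forall>x\<in>P. \<forall>y\<in>P. x + y \<in> P) \<and> (\<forall>x\<in>A. \<forall>y\<in>P. x * y \<in> P) \<and>
    (\<forall>x\<in>A. \<forall>y\<in>A. x * y \<in> P \<longrightarrow> x \<in> P \<or> y \<in> P) \<and>
    (\<forall>x\<in>P. \<forall>d. component d x \<in> P) \<and> (\<exists>d>0. \<not> G d \<subseteq> P)"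
  (is "_ \<longleftrightarrow> ?R")
proof -
  have pr: "primeideal P (ring_on A) \<Longrightarrow> P \<subseteq> A \<and> 0 \<in> P \<and> (\<forall>x\<in>P. \<forall>y\<in>P. x + y \<in> P)"
    by (simp add: primeideal_ring_on_iff[OF cring_A])
  show ?thesis
  proof
    assume "P \<in> Proj_points A G"
    then have P: "primeideal P (ring_on A)" "homogeneous_set G P" "\<not> irrelevant_ideal G \<subseteq> P"
      by (simp_all add: Proj_points_def)
    have "\<forall>x\<in>P. \<forall>d. component d x \<in> P"
      using homogeneous_set_iff pr[OF P(1)] P(2) by blast
    moreover have "\<exists>d>0. \<not> G d \<subseteq> P"
      using irrelevant_ideal_subset_iff[of P] pr[OF P(1)] P(3) by auto
    ultimately show ?R
      using P(1) by (simp add: primeideal_ring_on_iff[OF cring_A])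
  next
    assume R: ?R
    \<comment> \<open>Properness follows from the last condition: all pieces lie in
      \<open>A\<close>, and one of them is not inside \<open>P\<close>.\<close>
    have "P \<noteq> A" using R piece_subset by auto
    then have "primeideal P (ring_on A)"
      using R by (simp add: primeideal_ring_on_iff[OF cring_A])
    moreover have "homogeneous_set G P" using homogeneous_set_iff[of P] R by simp
    moreover have "\<not> irrelevant_ideal G \<subseteq> P" using irrelevant_ideal_subset_iff[of P] R by auto
    ultimately show "P \<in> Proj_points A G" by (simp add: Proj_points_def)
  qed
qed

lemma Proj_pointsD:
  assumes "P \<in> Proj_points A G"
  shows "P \<subseteq> A" "0 \<in> P" "\<lbrakk>x \<in> P; y \<in> P\<rbrakk> \<Longrightarrow> x + y \<in> P" "\<lbrakk>x \<in> A; y \<in> P\<rbrakk> \<Longrightarrow> x * y \<in> P"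
    "\<lbrakk>x \<in> A; y \<in> A; x * y \<in> P\<rbrakk> \<Longrightarrow> x \<in> P \<or> y \<in> P"
    "x \<in> P \<Longrightarrow> component d x \<in> P" "\<exists>d>0. \<not> G d \<subseteq> P"
  using assms unfolding Proj_points_iff by simp_all

lemma Proj_points_sum:
  assumes "P \<in> Proj_points A G" "\<And>i. i \<in> I \<Longrightarrow> f i \<in> P"
  shows "sum f I \<in> P"
  using assms(2) by (induction I rule: infinite_finite_induct) (auto simp: Proj_pointsD[OF assms(1)])

lemma Proj_points_component_iff:
  assumes "P \<in> Proj_points A G" "x \<in> A"
  shows "x \<in> P \<longleftrightarrow> (\<forall>d. component d x \<in> P)"
  using decompE[OF assms(2)] Proj_points_sum[OF assms(1)] Proj_pointsD(6)[OF assms(1)] by metis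

lemma Proj_points_one: "P \<in> Proj_points A G \<Longrightarrow> 1 \<notin> P"
  using Proj_pointsD(1,4,7)[of P] piece_mem by (metis mult.right_neutral subsetI)

lemma Proj_points_power_iff:
  assumes "P \<in> Proj_points A G" "x \<in> A" "0 < m"
  shows "x ^ m \<in> P \<longleftrightarrow> x \<in> P"
proof
  have pow: "x ^ i \<in> A" for i using assms(2) by (induction i) (auto simp: A_closed)
  \<comment> \<open>In the base case \<open>x ^ 0 = 1\<close> lies outside \<open>P\<close>, so the
    implication is vacuous there.\<close>
  have "x ^ i \<in> P \<Longrightarrow> x \<in> P" for i
    by (induction i) (use Proj_pointsD(5)[OF assms(1,2) pow] Proj_points_one[OF assms(1)] in auto)
  then show "x ^ m \<in> P \<Longrightarrow> x \<in> P" .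
  show "x ^ m \<in> P" if "x \<in> P"
    using Proj_pointsD(4)[OF assms(1) pow[of "m - 1"] that] assms(3)
    by (metis power_minus_mult)
qed

text \<open>
  Primality only has to be tested on homogeneous elements: in a product of two elements outside
  the ideal look at the product of the lowest components that are outside.
\<close>

lemma Proj_pointsI:
  assumes sub: "P \<subseteq> A" and zero: "0 \<in> P"
    and add: "\<And>x y. \<lbrakk>x \<in> P; y \<in> P\<rbrakk> \<Longrightarrow> x + y \<in> P"
    and mult: "\<And>d x y. \<lbrakk>x \<in> A; y \<in> P; y \<in> G d\<rbrakk> \<Longrightarrow> x * y \<in> P"
    and prime: "\<And>d e x y. \<lbrakk>x \<in> G d; y \<in> G e; x * y \<in> P\<rbrakk> \<Longrightarrow> x \<in> P \<or> y \<in> P"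
    and comp: "\<And>d x. x \<in> P \<Longrightarrow> component d x \<in> P"
    and irr: "\<exists>d>0. \<not> G d \<subseteq> P"
  shows "P \<in> Proj_points A G"
proof -
  have sum: "sum f I \<in> P" if "\<And>i. i \<in> I \<Longrightarrow> f i \<in> P" for f and I :: "nat set"
    using that by (induction I rule: infinite_finite_induct) (auto simp: zero add)
  have iff: "x \<in> P \<longleftrightarrow> (\<forall>d. component d x \<in> P)" if "x \<in> A" for x
    using decompE[OF that] sum comp by metis
  \<comment> \<open>\<open>mult\<close> covers only homogeneous \<open>y\<close>; an arbitrary
    \<open>y \<in> P\<close> is split into its components, which lie in \<open>P\<close> by
    \<open>comp\<close>.\<close>
  have mult': "x * y \<in> P" if "x \<in> A" "y \<in> P" for x y
  proof -
    have y: "y \<in> A" using that sub by blast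
    obtain D where D: "y = (\<Sum>d\<in>D. component d y)" using decompE[OF y] by blast
    have "x * y = (\<Sum>d\<in>D. x * component d y)"
      by (subst D) (rule sum_distrib_left)
    also have "\<dots> \<in> P"
      using that y by (intro sum mult[OF _ _ component_piece] comp) auto
    finally show ?thesis .
  qed
  have "x \<in> P \<or> y \<in> P" if x: "x \<in> A" and y: "y \<in> A" and xy: "x * y \<in> P" for x y
  proof (rule ccontr)
    assume "\<not> (x \<in> P \<or> y \<in> P)"
    then have ex: "\<exists>d. component d x \<notin> P" "\<exists>d. component d y \<notin> P"
      using iff x y by blast+
    define d where "d = (LEAST d. component d x \<notin> P)"
    define e where "e = (LEAST e. component e y \<notin> P)"
    have d: "component d x \<notin> P" "\<And>i. i < d \<Longrightarrow> component i x \<in> P"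
      using LeastI_ex[OF ex(1)] not_less_Least unfolding d_def by blast+
    have e: "component e y \<notin> P" "\<And>i. i < e \<Longrightarrow> component i y \<in> P"
      using LeastI_ex[OF ex(2)] not_less_Least unfolding e_def by blast+
    obtain D where D: "finite D" "x = (\<Sum>d\<in>D. component d x)" "\<And>d. d \<notin> D \<Longrightarrow> component d x = 0"
      using decompE[OF x] by blast
    have "d \<in> D" using D(3) d(1) zero by metis
    \<comment> \<open>\<open>t i\<close> is what the degree \<open>i\<close> part of
      \<open>x\<close> contributes to the degree \<open>d + e\<close> part of
      \<open>x * y\<close>.\<close>
    define t where "t i = (if i \<le> d + e then component i x * component (d + e - i) y else 0)" for i
    have comps: "component i x \<in> A" "component i y \<in> A" for i
      using component_piece x y piece_mem by blast+
    have "component (d + e) (x * y) = component (d + e) (\<Sum>i\<in>D. component i x * y)"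
      using D(2) by (simp add: sum_distrib_right[symmetric])
    also have "\<dots> = (\<Sum>i\<in>D. component (d + e) (component i x * y))"
      using comps y by (intro component_sum_A A_closed)
    also have "\<dots> = sum t D"
      unfolding t_def using component_mult_piece[OF component_piece[OF x] y] by simp
    also have "\<dots> = t d + sum t (D - {d})"
      using D(1) \<open>d \<in> D\<close> by (rule sum.remove)
    finally have eq: "t d = component (d + e) (x * y) + - 1 * sum t (D - {d})" by simp
    \<comment> \<open>For \<open>i < d\<close> the factor from \<open>x\<close> is in
      \<open>P\<close> by minimality of \<open>d\<close>; for \<open>i > d\<close> the index
      \<open>d + e - i\<close> is below \<open>e\<close>, so the factor from \<open>y\<close>
      is.\<close>
    have "t i \<in> P" if "i \<in> D - {d}" for i
    proof (cases "i < d")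
      case True
      then show ?thesis
        using mult'[OF comps(2) d(2)[OF True]] zero unfolding t_def by (subst mult.commute) auto
    next
      case False
      then show ?thesis using that zero mult'[OF comps(1) e(2)] unfolding t_def by auto
    qed
    then have "sum t (D - {d}) \<in> P" by (rule sum)
    then have "- 1 * sum t (D - {d}) \<in> P"
      using mult' piece_mem[OF piece_uminus[OF one_piece]] by blast
    then have "t d \<in> P" unfolding eq using comp[OF xy] by (intro add)
    then have "component d x * component e y \<in> P" by (simp add: t_def)
    then show False
      using prime[OF component_piece[OF x] component_piece[OF y]] d(1) e(1) by blast
  qed
  then show ?thesis
    unfolding Proj_points_iff using sub zero add mult' comp irr by simp
qed

end


lemma Proj_sections_localE:
  assumes "s \<in> Proj_sections A G U" "P \<in> U"
  obtains W d b h where "openin (Proj_top A G) W" "P \<in> W" "W \<subseteq> U" "b \<in> G d" "h \<in> G d"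
    "\<And>Q. Q \<in> W \<Longrightarrow> h \<notin> Q" "\<And>Q. Q \<in> W \<Longrightarrow> s Q = Fract b h"
proof -
  have "\<exists>W. openin (Proj_top A G) W \<and> P \<in> W \<and> W \<subseteq> U \<and>
      (\<exists>d b h. b \<in> G d \<and> h \<in> G d \<and> (\<forall>Q\<in>W. h \<notin> Q \<and> s Q = Fract b h))"
    using assms by (simp add: Proj_sections_def)
  then show thesis
  proof (elim exE conjE)
    fix W d b h
    assume "openin (Proj_top A G) W" "P \<in> W" "W \<subseteq> U" "b \<in> G d" "h \<in> G d"
      "\<forall>Q\<in>W. h \<notin> Q \<and> s Q = Fract b h"
    then show thesis by (intro that[of W b d h]) auto
  qed
qed


section \<open>Veronese subrings\<close>

text \<open>\<open>\<theta>\<close> identifies \<open>B\<close> with the \<open>N\<close>-th Veronese subring of \<open>A\<close>, degrees being divided by \<open>N\<close>.\<close>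

locale veronese = dom: graded_domain A G + cod: graded_domain B H
  for A :: "'a::idom set" and G and B :: "'b::idom set" and H +
  fixes \<theta> :: "'b \<Rightarrow> 'a" and N :: nat
  assumes N_pos: "0 < N"
    and theta_add: "\<theta> (x + y) = \<theta> x + \<theta> y"
    and theta_mult: "\<theta> (x * y) = \<theta> x * \<theta> y"
    and theta_one: "\<theta> 1 = 1"
    and theta_inj: "inj \<theta>"
    and theta_pieces: "\<theta> ` H e = G (N * e)"
begin

section \<open>Elementary properties of the Veronese embedding\<close>

lemma theta_zero: "\<theta> 0 = 0"
  using theta_add[of 0 0] by (metis add_0 add_cancel_right_right)

lemma theta_eq_iff: "\<theta> x = \<theta> y \<longleftrightarrow> x = y"
  using theta_inj by (auto dest: injD)

lemma theta_eq_0_iff: "\<theta> x = 0 \<longleftrightarrow> x = 0"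
  using theta_eq_iff[of x 0] by (simp add: theta_zero)

lemma theta_image_iff: "\<theta> x \<in> \<theta> ` S \<longleftrightarrow> x \<in> S"
  by (auto simp: theta_eq_iff)

lemma theta_power: "\<theta> (x ^ m) = \<theta> x ^ m"
  by (induction m) (simp_all add: theta_one theta_mult)

lemma theta_sum: "\<theta> (sum f I) = (\<Sum>i\<in>I. \<theta> (f i))"
  by (induction I rule: infinite_finite_induct) (simp_all add: theta_zero theta_add)

lemma theta_piece: "x \<in> H e \<Longrightarrow> \<theta> x \<in> G (N * e)"
  using theta_pieces by blast

lemma theta_mem:
  assumes "b \<in> B" shows "\<theta> b \<in> A"
proof -
  obtain D where D: "b = (\<Sum>d\<in>D. cod.component d b)" using cod.decompE[OF assms] by blast
  have "\<theta> b = (\<Sum>d\<in>D. \<theta> (cod.component d b))" by (subst D) (rule theta_sum)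
  also have "\<dots> \<in> A"
    by (intro dom.A_sum dom.piece_mem[OF theta_piece[OF cod.component_piece[OF assms]]])
  finally show ?thesis .
qed

text \<open>\<open>\<theta>\<close> maps the decomposition of \<open>b\<close> to one of
  \<open>\<theta> b\<close> with degree \<open>e\<close> moved to \<open>N * e\<close>; components
  are then read off term by term.\<close>

lemma component_theta:
  assumes "b \<in> B"
  shows "dom.component (N * e) (\<theta> b) = \<theta> (cod.component e b)"
    and "\<not> N dvd d \<Longrightarrow> dom.component d (\<theta> b) = 0"
proof -
  obtain D where D: "finite D" "b = (\<Sum>d\<in>D. cod.component d b)"
      "\<And>d. d \<notin> D \<Longrightarrow> cod.component d b = 0"
    using cod.decompE[OF assms] by blast
  have p: "\<theta> (cod.component e b) \<in> G (N * e)" for e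
    by (intro theta_piece cod.component_piece assms)
  have "\<theta> b = (\<Sum>i\<in>D. \<theta> (cod.component i b))" by (subst D(2)) (rule theta_sum)
  then have eq: "dom.component d (\<theta> b) = (\<Sum>i\<in>D. dom.component d (\<theta> (cod.component i b)))" for d
    using dom.component_sum_A[of D "\<lambda>i. \<theta> (cod.component i b)" d] dom.piece_mem[OF p] by simp
  then have eq: "dom.component d (\<theta> b) = (\<Sum>i\<in>D. if d = N * i then \<theta> (cod.component i b) else 0)" for d
    using dom.component_of_piece[OF p] by simp
  show "dom.component (N * e) (\<theta> b) = \<theta> (cod.component e b)"
    unfolding eq using N_pos D(1,3) by (simp add: theta_zero)
  show "dom.component d (\<theta> b) = 0" if "\<not> N dvd d"
    unfolding eq using that by (intro sum.neutral) auto
qed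

text \<open>The \<open>N\<close>-th power of an element of degree \<open>d\<close> has degree
  \<open>N * d\<close>, hence lies in the image of \<open>\<theta>\<close>. This is the passage from
  homogeneous elements of \<open>A\<close> to those of \<open>B\<close>.\<close>

lemma power_pieceE:
  assumes "x \<in> G d"
  obtains z where "z \<in> H d" "\<theta> z = x ^ N"
  using dom.piece_power[OF assms, of N] theta_pieces[of d] that by (metis imageE)

section \<open>The bijection between points\<close>

definition fwd :: "'a set \<Rightarrow> 'b set" where
  "fwd P = {b \<in> B. \<theta> b \<in> P}"

text \<open>The power test is imposed on each component, because \<open>N\<close>-th powers of
  homogeneous elements are the ones known to lie in the image of \<open>\<theta>\<close>;
  homogeneity is thus built in.\<close>

definition bwd :: "'b set \<Rightarrow> 'a set" where
  "bwd Q = {x \<in> A. \<forall>d. dom.component d x ^ N \<in> \<theta> ` Q}"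

lemma fwd_points:
  assumes P: "P \<in> Proj_points A G"
  shows "fwd P \<in> Proj_points B H"
proof (rule cod.Proj_pointsI)
  note P' = dom.Proj_pointsD[OF P]
  show "fwd P \<subseteq> B" "0 \<in> fwd P"
    using P' by (auto simp: fwd_def theta_zero cod.A_closed)
  show "x + y \<in> fwd P" if "x \<in> fwd P" "y \<in> fwd P" for x y
    using that P'(3) by (auto simp: fwd_def theta_add cod.A_closed)
  show "x * y \<in> fwd P" if "x \<in> B" "y \<in> fwd P" for x y
    using that P'(4) by (auto simp: fwd_def theta_mult cod.A_closed theta_mem)
  show "x \<in> fwd P \<or> y \<in> fwd P" if "x \<in> H d" "y \<in> H e" "x * y \<in> fwd P" for x y d e
    using that P'(5)[of "\<theta> x" "\<theta> y"] cod.piece_mem theta_mem by (auto simp: fwd_def theta_mult)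
  show "cod.component d x \<in> fwd P" if "x \<in> fwd P" for d x
    using that P'(6)[of "\<theta> x" "N * d"] cod.piece_mem[OF cod.component_piece, of x d]
    by (auto simp: fwd_def component_theta)
  \<comment> \<open>A homogeneous element of positive degree outside \<open>P\<close> yields,
    through its \<open>N\<close>-th power, an element of \<open>H d\<close> outside
    \<open>fwd P\<close>.\<close>
  obtain d x where x: "d > 0" "x \<in> G d" "x \<notin> P" using P'(7) by blast
  obtain z where z: "z \<in> H d" "\<theta> z = x ^ N" using power_pieceE[OF x(2)] .
  then have "z \<notin> fwd P"
    using x dom.Proj_points_power_iff[OF P _ N_pos, of x] dom.piece_mem by (auto simp: fwd_def)
  then show "\<exists>d>0. \<not> H d \<subseteq> fwd P" using x z by blast
qed

text \<open>All other components of a homogeneous \<open>x\<close> are 0, and these pass the test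
  because \<open>0 ^ N = 0\<close> for positive \<open>N\<close>.\<close>

lemma bwd_piece_iff:
  assumes "Q \<in> Proj_points B H" "x \<in> G d"
  shows "x \<in> bwd Q \<longleftrightarrow> x ^ N \<in> \<theta> ` Q"
proof -
  have "0 ^ N \<in> \<theta> ` Q"
    using cod.Proj_pointsD(2)[OF assms(1)] theta_zero N_pos by (metis imageI zero_power)
  then show ?thesis
    using assms(2) dom.piece_mem by (auto simp: bwd_def dom.component_of_piece)
qed

text \<open>
  For \<open>u\<close>, \<open>v\<close> of degree \<open>d\<close>, every term of the binomial expansion of \<open>(u + v) ^ (2 * N)\<close> is
  divisible by \<open>u ^ N\<close> or \<open>v ^ N\<close>, with a cofactor of degree \<open>N * d\<close>, which lies in the image of \<open>\<theta>\<close>.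
\<close>

lemma power_add_mem:
  assumes Q: "Q \<in> Proj_points B H" and u: "u \<in> G d" "u ^ N \<in> \<theta> ` Q"
    and v: "v \<in> G d" "v ^ N \<in> \<theta> ` Q"
  shows "(u + v) ^ N \<in> \<theta> ` Q"
proof -
  note Q' = cod.Proj_pointsD[OF Q]
  have absorb: "q * r \<in> \<theta> ` Q" if "q \<in> \<theta> ` Q" "r \<in> \<theta> ` B" for q r
    using that Q'(4) by (auto simp: theta_mult[symmetric] theta_image_iff) (metis mult.commute)
  have sums: "sum f I \<in> \<theta> ` Q" if "\<And>i. i \<in> I \<Longrightarrow> f i \<in> \<theta> ` Q" for f and I :: "nat set"
    using that
  proof (induction I rule: infinite_finite_induct)
    case (insert i I)
    then obtain q r where "f i = \<theta> q" "sum f I = \<theta> r" "q \<in> Q" "r \<in> Q" by blast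
    then show ?case using insert Q'(3)[of q r] by (simp add: theta_add[symmetric] theta_image_iff)
  qed (use Q'(2) theta_zero in \<open>metis sum.infinite sum.empty imageI\<close>)+
  \<comment> \<open>The binomial coefficients belong to the image of \<open>B\<close> because
    \<open>\<theta>\<close> fixes natural numbers.\<close>
  have of_nat: "of_nat m \<in> \<theta> ` B" for m
  proof -
    have "\<theta> (of_nat m) = of_nat m" "of_nat m \<in> B"
      by (induction m) (simp_all add: theta_zero theta_add theta_one cod.A_closed)
    then show ?thesis by (metis imageI)
  qed
  have mono: "u ^ i * v ^ j \<in> \<theta> ` B" if "i + j = N" for i j
  proof -
    have "u ^ i * v ^ j \<in> G (i * d + j * d)"
      using u(1) v(1) by (intro dom.mult_piece dom.piece_power)
    also have "i * d + j * d = N * d" using that by (metis add_mult_distrib)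
    finally have "u ^ i * v ^ j \<in> \<theta> ` H d" unfolding theta_pieces .
    then show ?thesis using cod.piece_subset by blast
  qed
  have "of_nat ((2 * N) choose k) * u ^ k * v ^ (2 * N - k) \<in> \<theta> ` Q" if k: "k \<le> 2 * N" for k
  proof (cases "N \<le> k")
    case True
    then have "of_nat ((2 * N) choose k) * u ^ k * v ^ (2 * N - k) =
        u ^ N * (u ^ (k - N) * v ^ (2 * N - k)) * of_nat ((2 * N) choose k)"
      using power_add[of u N "k - N"] by (simp add: algebra_simps)
    also have "\<dots> \<in> \<theta> ` Q"
      using True k by (intro absorb u mono of_nat) auto
    finally show ?thesis .
  next
    case False
    then have "of_nat ((2 * N) choose k) * u ^ k * v ^ (2 * N - k) =
        v ^ N * (u ^ k * v ^ (N - k)) * of_nat ((2 * N) choose k)"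
      using power_add[of v N "N - k"] by (simp add: algebra_simps mult_2_right)
    also have "\<dots> \<in> \<theta> ` Q"
      using False k by (intro absorb v mono of_nat) auto
    finally show ?thesis .
  qed
  then have "(u + v) ^ (2 * N) \<in> \<theta> ` Q"
    unfolding binomial_ring by (intro sums) auto
  \<comment> \<open>The expansion only gives the \<open>2 * N\<close>-th power. Since
    \<open>(u + v) ^ N\<close> is itself \<open>\<theta> z\<close>, primality of \<open>Q\<close>
    applied to \<open>z ^ 2\<close> recovers the \<open>N\<close>-th.\<close>
  moreover obtain z where z: "z \<in> H d" "\<theta> z = (u + v) ^ N"
    using power_pieceE[OF dom.piece_add[OF u(1) v(1)]] .
  then have "(u + v) ^ (2 * N) = \<theta> (z ^ 2)"
    by (simp add: theta_power power_mult[symmetric] mult.commute)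
  ultimately have "z ^ 2 \<in> Q" by (simp add: theta_image_iff)
  then have "z \<in> Q" using cod.Proj_points_power_iff[OF Q] cod.piece_mem[OF z(1)] by simp
  then show ?thesis using z(2) by (metis imageI)
qed

text \<open>Addition is \<open>power_add_mem\<close> in each degree. For products,
  \<open>Proj_pointsI\<close> leaves at least one homogeneous factor, so components of a product are
  products, and their \<open>N\<close>-th powers descend to \<open>B\<close>.\<close>

lemma bwd_points:
  assumes Q: "Q \<in> Proj_points B H"
  shows "bwd Q \<in> Proj_points A G"
proof (rule dom.Proj_pointsI)
  note Q' = cod.Proj_pointsD[OF Q]
  show "bwd Q \<subseteq> A" by (auto simp: bwd_def)
  show "0 \<in> bwd Q"
    using bwd_piece_iff[OF Q dom.piece_subgroup(1)] N_pos Q'(2) theta_zero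
    by (metis imageI zero_power)
  show "x + y \<in> bwd Q" if "x \<in> bwd Q" "y \<in> bwd Q" for x y
    using that power_add_mem[OF Q dom.component_piece _ dom.component_piece, of x _ y]
    by (auto simp: bwd_def dom.component_add dom.A_closed)
  show "x * y \<in> bwd Q" if x: "x \<in> A" and y: "y \<in> bwd Q" "y \<in> G d" for d x y
  proof -
    have "dom.component e (x * y) ^ N \<in> \<theta> ` Q" for e
    proof (cases "d \<le> e")
      case True
      obtain q where q: "q \<in> Q" "y ^ N = \<theta> q"
        using y bwd_piece_iff[OF Q y(2)] by blast
      obtain z where z: "z \<in> H (e - d)" "\<theta> z = dom.component (e - d) x ^ N"
        using power_pieceE[OF dom.component_piece[OF x]] .
      have "dom.component e (x * y) ^ N = \<theta> (z * q)"
        using dom.component_mult_piece[OF y(2) x, of e] True q z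
        by (simp add: mult.commute theta_mult power_mult_distrib)
      then show ?thesis using Q'(4)[of z q] cod.piece_mem z q by (simp add: theta_image_iff)
    next
      case False
      then have "dom.component e (x * y) ^ N = \<theta> 0"
        using dom.component_mult_piece[OF y(2) x, of e] N_pos by (simp add: mult.commute theta_zero)
      then show ?thesis using Q'(2) by simp
    qed
    then show ?thesis using that dom.piece_mem by (simp add: bwd_def dom.A_closed)
  qed
  show "x \<in> bwd Q \<or> y \<in> bwd Q" if x: "x \<in> G d" and y: "y \<in> G e" and xy: "x * y \<in> bwd Q" for d e x y
  proof -
    obtain z where z: "z \<in> H d" "\<theta> z = x ^ N" using power_pieceE[OF x] .
    obtain w where w: "w \<in> H e" "\<theta> w = y ^ N" using power_pieceE[OF y] .
    have "\<theta> (z * w) \<in> \<theta> ` Q"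
      using xy bwd_piece_iff[OF Q dom.mult_piece[OF x y]] z w
      by (simp add: theta_mult power_mult_distrib)
    then have "z \<in> Q \<or> w \<in> Q"
      using Q'(5) z(1) w(1) cod.piece_mem by (auto simp: theta_image_iff)
    then show ?thesis
      using bwd_piece_iff[OF Q] x y z(2) w(2) by (metis imageI)
  qed
  show "dom.component d x \<in> bwd Q" if "x \<in> bwd Q" for d x
    using that bwd_piece_iff[OF Q dom.component_piece, of x d] by (simp add: bwd_def)
  \<comment> \<open>Here the passage is direct: \<open>\<theta> z\<close> has degree
    \<open>N * e > 0\<close>, and its \<open>N\<close>-th power is the image of
    \<open>z ^ N\<close>, which is outside \<open>Q\<close>.\<close>
  obtain e z where z: "e > 0" "z \<in> H e" "z \<notin> Q" using Q'(7) by blast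
  then have "\<theta> z ^ N \<notin> \<theta> ` Q"
    using cod.Proj_points_power_iff[OF Q cod.piece_mem[OF z(2)] N_pos]
    by (simp add: theta_power[symmetric] theta_image_iff)
  then have "\<theta> z \<notin> bwd Q"
    using bwd_piece_iff[OF Q theta_piece[OF z(2)]] by simp
  then show "\<exists>d>0. \<not> G d \<subseteq> bwd Q"
    using theta_piece[OF z(2)] z(1) N_pos by (metis nat_0_less_mult_iff subsetD)
qed

text \<open>\<open>\<theta> b\<close> has components only in degrees \<open>N * e\<close>, where the
  power test says that the \<open>N\<close>-th power of \<open>cod.component e b\<close> lies in
  \<open>Q\<close>; primality removes the power.\<close>

lemma fwd_bwd:
  assumes Q: "Q \<in> Proj_points B H"
  shows "fwd (bwd Q) = Q"
proof -
  note Q' = cod.Proj_pointsD[OF Q]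
  have "\<theta> b \<in> bwd Q \<longleftrightarrow> b \<in> Q" if b: "b \<in> B" for b
  proof -
    have "dom.component d (\<theta> b) ^ N \<in> \<theta> ` Q" if "\<not> N dvd d" for d
      using component_theta(2)[OF b that] N_pos Q'(2) theta_zero by (metis imageI zero_power)
    then have "(\<forall>d. dom.component d (\<theta> b) ^ N \<in> \<theta> ` Q) \<longleftrightarrow>
        (\<forall>e. dom.component (N * e) (\<theta> b) ^ N \<in> \<theta> ` Q)"
      by (metis dvdE)
    then have "\<theta> b \<in> bwd Q \<longleftrightarrow> (\<forall>e. dom.component (N * e) (\<theta> b) ^ N \<in> \<theta> ` Q)"
      using theta_mem[OF b] by (simp add: bwd_def)
    also have "\<dots> \<longleftrightarrow> (\<forall>e. cod.component e b \<in> Q)"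
      using cod.Proj_points_power_iff[OF Q cod.piece_mem[OF cod.component_piece[OF b]] N_pos]
      by (simp add: component_theta(1)[OF b] theta_power[symmetric] theta_image_iff)
    also have "\<dots> \<longleftrightarrow> b \<in> Q" using cod.Proj_points_component_iff[OF Q b] by simp
    finally show ?thesis .
  qed
  then show ?thesis using Q'(1) by (auto simp: fwd_def)
qed

text \<open>The \<open>N\<close>-th power of a component descends to some \<open>z\<close>, and
  \<open>z \<in> fwd P\<close> means that this power lies in \<open>P\<close>; primality again
  removes the power.\<close>

lemma bwd_fwd:
  assumes P: "P \<in> Proj_points A G"
  shows "bwd (fwd P) = P"
proof -
  have "x \<in> bwd (fwd P) \<longleftrightarrow> x \<in> P" if x: "x \<in> A" for x
  proof -
    have "dom.component d x ^ N \<in> \<theta> ` fwd P \<longleftrightarrow> dom.component d x \<in> P" for d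
    proof -
      obtain z where z: "z \<in> H d" "\<theta> z = dom.component d x ^ N"
        using power_pieceE[OF dom.component_piece[OF x]] .
      have "dom.component d x ^ N \<in> \<theta> ` fwd P \<longleftrightarrow> dom.component d x ^ N \<in> P"
        unfolding z(2)[symmetric] theta_image_iff using cod.piece_mem[OF z(1)] by (simp add: fwd_def)
      then show ?thesis
        using dom.Proj_points_power_iff[OF P dom.piece_mem[OF dom.component_piece[OF x]] N_pos] by simp
    qed
    then show ?thesis
      using dom.Proj_points_component_iff[OF P x] x by (simp add: bwd_def)
  qed
  then show ?thesis
    using dom.Proj_pointsD(1)[OF P] by (auto simp: bwd_def)
qed

section \<open>Continuity of the two maps\<close>

lemma continuous_fwd: "continuous_map (Proj_top A G) (Proj_top B H) fwd"
  unfolding continuous_map_def dom.topspace_Proj_top cod.topspace_Proj_top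
proof (intro conjI allI impI)
  show "fwd \<in> Proj_points A G \<rightarrow> Proj_points B H" using fwd_points by blast
  fix V assume "openin (Proj_top B H) V"
  then obtain E where E: "E \<subseteq> (\<Union>d. H d)" "V = Proj_points B H - Vplus B H E"
    unfolding cod.openin_Proj_top Proj_open_def by blast
  \<comment> \<open>The closed set cut out by \<open>E\<close> pulls back to the one cut out by the
    images of \<open>E\<close> under \<open>\<theta>\<close>.\<close>
  have "E \<subseteq> fwd P \<longleftrightarrow> \<theta> ` E \<subseteq> P" for P
    using E(1) cod.piece_mem by (fastforce simp: fwd_def)
  then have "{P \<in> Proj_points A G. fwd P \<in> V} = Proj_points A G - Vplus A G (\<theta> ` E)"
    using fwd_points by (auto simp: E(2) Vplus_def)
  moreover have "\<theta> ` E \<subseteq> (\<Union>d. G d)" using E(1) theta_piece by blast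
  ultimately show "openin (Proj_top A G) {P \<in> Proj_points A G. fwd P \<in> V}"
    unfolding dom.openin_Proj_top Proj_open_def by blast
qed

lemma continuous_bwd: "continuous_map (Proj_top B H) (Proj_top A G) bwd"
  unfolding continuous_map_def dom.topspace_Proj_top cod.topspace_Proj_top
proof (intro conjI allI impI)
  show "bwd \<in> Proj_points B H \<rightarrow> Proj_points A G" using bwd_points by blast
  fix U assume "openin (Proj_top A G) U"
  then obtain E where E: "E \<subseteq> (\<Union>d. G d)" "U = Proj_points A G - Vplus A G E"
    unfolding dom.openin_Proj_top Proj_open_def by blast
  \<comment> \<open>Equations of the pulled-back closed set: \<open>N\<close>-th powers of elements
    of \<open>E\<close>, descended to \<open>B\<close>.\<close>
  define F where "F = {z \<in> (\<Union>d. H d). \<exists>x\<in>E. \<theta> z = x ^ N}"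
  have "E \<subseteq> bwd Q \<longleftrightarrow> F \<subseteq> Q" if Q: "Q \<in> Proj_points B H" for Q
  proof
    assume "E \<subseteq> bwd Q"
    then have "x ^ N \<in> \<theta> ` Q" if "x \<in> E" for x
      using that E(1) bwd_piece_iff[OF Q] by blast
    then have "\<theta> z \<in> \<theta> ` Q" if "z \<in> F" for z
      using that unfolding F_def by auto
    then show "F \<subseteq> Q"
      unfolding theta_image_iff by blast
  next
    assume F: "F \<subseteq> Q"
    show "E \<subseteq> bwd Q"
    proof
      fix x assume x: "x \<in> E"
      then obtain d where d: "x \<in> G d" using E(1) by blast
      then obtain z where z: "z \<in> H d" "\<theta> z = x ^ N" using power_pieceE by blast
      then have "z \<in> Q" using F x unfolding F_def by blast
      then have "x ^ N \<in> \<theta> ` Q" unfolding z(2)[symmetric] by blast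
      then show "x \<in> bwd Q" using bwd_piece_iff[OF Q d] by simp
    qed
  qed
  then have "{Q \<in> Proj_points B H. bwd Q \<in> U} = Proj_points B H - Vplus B H F"
    using bwd_points by (auto simp: E(2) Vplus_def)
  moreover have "F \<subseteq> (\<Union>d. H d)" unfolding F_def by blast
  ultimately show "openin (Proj_top B H) {Q \<in> Proj_points B H. bwd Q \<in> U}"
    unfolding cod.openin_Proj_top Proj_open_def by blast
qed


subsection \<open>Comparison of sections\<close>

text \<open>The map of fraction fields induced by the injective \<open>\<theta>\<close>; the
  uniqueness behind \<open>THE\<close> is proved in \<open>frac_Fract\<close>.\<close>

definition frac :: "'b fract \<Rightarrow> 'a fract" where
  "frac q = (THE r. \<exists>b h. h \<noteq> 0 \<and> q = Fract b h \<and> r = Fract (\<theta> b) (\<theta> h))"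

text \<open>\<open>\<theta>\<close> preserves the cross-multiplied equation of two representatives,
  and its injectivity keeps denominators nonzero.\<close>

lemma frac_Fract:
  assumes "h \<noteq> 0" shows "frac (Fract b h) = Fract (\<theta> b) (\<theta> h)"
  unfolding frac_def
proof (rule the_equality)
  fix r assume "\<exists>b' h'. h' \<noteq> 0 \<and> Fract b h = Fract b' h' \<and> r = Fract (\<theta> b') (\<theta> h')"
  then obtain b' h' where *: "h' \<noteq> 0" "Fract b h = Fract b' h'" "r = Fract (\<theta> b') (\<theta> h')" by blast
  then have "\<theta> (b * h') = \<theta> (b' * h)" using assms by (simp add: eq_fract)
  then show "r = Fract (\<theta> b) (\<theta> h)"
    using * assms by (simp add: eq_fract theta_mult theta_eq_0_iff)
qed (use assms in blast)

lemma frac_add: "frac (q + r) = frac q + frac r"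
  by (cases q; cases r) (simp add: frac_Fract theta_add theta_mult theta_eq_0_iff)

lemma frac_mult: "frac (q * r) = frac q * frac r"
  by (cases q; cases r) (simp add: frac_Fract theta_mult)

lemma frac_one: "frac 1 = 1"
  by (simp add: One_fract_def frac_Fract theta_one)

lemma frac_inj: "inj frac"
proof (rule injI)
  fix q r assume "frac q = frac r"
  then show "q = r"
    by (cases q; cases r)
      (simp add: frac_Fract eq_fract theta_eq_0_iff theta_mult[symmetric] theta_eq_iff)
qed

text \<open>An inverse of \<open>frac\<close> on its range, where the values of sections lie by
  \<open>section_in_range_frac\<close>.\<close>

definition unfrac :: "'a fract \<Rightarrow> 'b fract" where
  "unfrac = inv_into UNIV frac"

lemma unfrac_frac: "unfrac (frac q) = q"
  unfolding unfrac_def using frac_inj by (rule inv_f_f)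

lemma frac_unfrac: "r \<in> range frac \<Longrightarrow> frac (unfrac r) = r"
  unfolding unfrac_def by (rule f_inv_into_f)

text \<open>The pair \<open>u\<close>, \<open>v\<close> is chosen before \<open>Q\<close>, so a
  single pair represents a section on a whole open set and not just at one point.\<close>

lemma fractionE:
  assumes "b \<in> G d" "h \<in> G d"
  obtains u v where "u \<in> H d" "v \<in> H d"
    "\<And>Q. \<lbrakk>Q \<in> Proj_points B H; h \<notin> bwd Q\<rbrakk> \<Longrightarrow> v \<notin> Q \<and> Fract b h = frac (Fract u v)"
proof -
  have "b * h ^ (N - 1) \<in> G (d + (N - 1) * d)"
    using assms by (intro dom.mult_piece dom.piece_power)
  also have "d + (N - 1) * d = N * d" using N_pos by (metis Suc_diff_1 mult_Suc)
  finally obtain u where u: "u \<in> H d" "\<theta> u = b * h ^ (N - 1)"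
    using theta_pieces[of d] by (metis imageE)
  obtain v where v: "v \<in> H d" "\<theta> v = h ^ N" using power_pieceE[OF assms(2)] .
  have "v \<notin> Q \<and> Fract b h = frac (Fract u v)" if Q: "Q \<in> Proj_points B H" and h: "h \<notin> bwd Q" for Q
  proof -
    have vQ: "v \<notin> Q" using bwd_piece_iff[OF Q assms(2)] h v(2) by (metis imageI)
    then have "v \<noteq> 0" using cod.Proj_pointsD(2)[OF Q] by blast
    moreover have "h \<noteq> 0" using h dom.Proj_pointsD(2)[OF bwd_points[OF Q]] by blast
    moreover have "h ^ N = h * h ^ (N - 1)" using N_pos by (metis power_eq_if neq0_conv)
    ultimately show ?thesis
      using vQ by (simp add: frac_Fract u v eq_fract theta_eq_0_iff)
  qed
  then show thesis using that u(1) v(1) by blast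
qed

section \<open>The comorphisms on sections\<close>

definition pull :: "'b set set \<Rightarrow> ('b set \<Rightarrow> 'b fract) \<Rightarrow> 'a set \<Rightarrow> 'a fract" where
  "pull V s = (\<lambda>P\<in>{P \<in> Proj_points A G. fwd P \<in> V}. frac (s (fwd P)))"

definition push :: "'a set set \<Rightarrow> ('a set \<Rightarrow> 'a fract) \<Rightarrow> 'b set \<Rightarrow> 'b fract" where
  "push U t = (\<lambda>Q\<in>{Q \<in> Proj_points B H. bwd Q \<in> U}. unfrac (t (bwd Q)))"

lemma pull_sections:
  assumes V: "openin (Proj_top B H) V" and s: "s \<in> Proj_sections B H V"
  shows "pull V s \<in> Proj_sections A G {P \<in> Proj_points A G. fwd P \<in> V}" (is "_ \<in> Proj_sections A G ?U")
  unfolding Proj_sections_def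
proof (intro CollectI conjI ballI)
  \<comment> \<open>\<open>h\<close> is nonzero since \<open>fwd P\<close> contains 0 but not
    \<open>h\<close>; this is what allows \<open>frac\<close> to be evaluated on the given
    representative.\<close>
  have *: "frac (Fract b h) = Fract (\<theta> b) (\<theta> h) \<and> \<theta> h \<notin> P \<and> \<theta> b \<in> G (N * d) \<and> \<theta> h \<in> G (N * d)"
    if "P \<in> Proj_points A G" "b \<in> H d" "h \<in> H d" "h \<notin> fwd P" for P b h d
  proof -
    have "h \<noteq> 0" using that cod.Proj_pointsD(2)[OF fwd_points] by blast
    then show ?thesis using that frac_Fract theta_piece cod.piece_mem by (auto simp: fwd_def)
  qed
  show "pull V s \<in> PiE ?U (hom_localization G)"
  proof (rule PiE_I)
    fix P assume P: "P \<in> ?U"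
    then have "s (fwd P) \<in> hom_localization H (fwd P)"
      using s by (auto simp: Proj_sections_def)
    then show "pull V s P \<in> hom_localization G P"
      using P * unfolding hom_localization_def pull_def by fastforce
  qed (auto simp: pull_def)
  fix P assume P: "P \<in> ?U"
  then obtain W d b h where W: "openin (Proj_top B H) W" "fwd P \<in> W" "W \<subseteq> V"
      and bh: "b \<in> H d" "h \<in> H d" "\<And>Q. Q \<in> W \<Longrightarrow> h \<notin> Q" "\<And>Q. Q \<in> W \<Longrightarrow> s Q = Fract b h"
    by (auto elim: Proj_sections_localE[OF s, of "fwd P"])
  let ?W = "{P \<in> Proj_points A G. fwd P \<in> W}"
  have "openin (Proj_top A G) ?W"
    using openin_continuous_map_preimage[OF continuous_fwd W(1)] by (simp add: dom.topspace_Proj_top)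
  moreover have "\<theta> h \<notin> R \<and> pull V s R = Fract (\<theta> b) (\<theta> h)" if "R \<in> ?W" for R
    using that bh * W(3) by (auto simp: pull_def)
  moreover have "\<theta> b \<in> G (N * d)" "\<theta> h \<in> G (N * d)" using bh theta_piece by auto
  ultimately show "\<exists>W. openin (Proj_top A G) W \<and> P \<in> W \<and> W \<subseteq> ?U \<and>
      (\<exists>d b h. b \<in> G d \<and> h \<in> G d \<and> (\<forall>Q\<in>W. h \<notin> Q \<and> pull V s Q = Fract b h))"
    using P W(2,3) by (intro exI[of _ ?W]) blast
qed

text \<open>Values of sections are fractions of elements of equal degree, which
  \<open>fractionE\<close> rewrites over \<open>B\<close>. On such values \<open>unfrac\<close>
  respects sums and products.\<close>

lemma section_in_range_frac:
  assumes "t \<in> Proj_sections A G U" "Q \<in> Proj_points B H" "bwd Q \<in> U"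
  shows "t (bwd Q) \<in> range frac"
proof -
  have "t (bwd Q) \<in> hom_localization G (bwd Q)"
    using assms by (auto simp: Proj_sections_def)
  then obtain b h d where bh: "t (bwd Q) = Fract b h" "b \<in> G d" "h \<in> G d" "h \<notin> bwd Q"
    unfolding hom_localization_def by blast
  then obtain u v where "Fract b h = frac (Fract u v)"
    using assms(2) fractionE[OF bh(2,3)] by metis
  then show ?thesis using bh(1) by simp
qed

lemma push_sections:
  assumes U: "openin (Proj_top A G) U" and t: "t \<in> Proj_sections A G U"
  shows "push U t \<in> Proj_sections B H {Q \<in> Proj_points B H. bwd Q \<in> U}" (is "_ \<in> Proj_sections B H ?V")
proof -
  have loc: "\<exists>W. openin (Proj_top B H) W \<and> Q \<in> W \<and> W \<subseteq> ?V \<and>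
      (\<exists>d b h. b \<in> H d \<and> h \<in> H d \<and> (\<forall>R\<in>W. h \<notin> R \<and> push U t R = Fract b h))" if Q: "Q \<in> ?V" for Q
  proof -
    obtain W d b h where W: "openin (Proj_top A G) W" "bwd Q \<in> W" "W \<subseteq> U"
        and bh: "b \<in> G d" "h \<in> G d" "\<And>P. P \<in> W \<Longrightarrow> h \<notin> P" "\<And>P. P \<in> W \<Longrightarrow> t P = Fract b h"
      using Q by (auto elim: Proj_sections_localE[OF t, of "bwd Q"])
    obtain u v where uv: "u \<in> H d" "v \<in> H d"
      "\<And>Q. \<lbrakk>Q \<in> Proj_points B H; h \<notin> bwd Q\<rbrakk> \<Longrightarrow> v \<notin> Q \<and> Fract b h = frac (Fract u v)"
      using fractionE[OF bh(1,2)] by blast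
    let ?W = "{Q \<in> Proj_points B H. bwd Q \<in> W}"
    have "openin (Proj_top B H) ?W"
      using openin_continuous_map_preimage[OF continuous_bwd W(1)] by (simp add: cod.topspace_Proj_top)
    moreover have "v \<notin> R \<and> push U t R = Fract u v" if R: "R \<in> ?W" for R
    proof -
      have "v \<notin> R" "t (bwd R) = frac (Fract u v)"
        using R bh(3,4)[of "bwd R"] uv(3)[of R] by auto
      then show ?thesis using R W(3) by (auto simp: push_def unfrac_frac)
    qed
    ultimately show ?thesis using Q W(2,3) uv(1,2) by (intro exI[of _ ?W]) blast
  qed
  \<comment> \<open>Membership in the homogeneous localization is read off from the local
    representation at \<open>Q\<close> itself.\<close>
  moreover have "push U t Q \<in> hom_localization H Q" if Q: "Q \<in> ?V" for Q
    using loc[OF Q] unfolding hom_localization_def by blast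
  moreover have "push U t \<in> extensional ?V" by (simp add: push_def)
  ultimately show ?thesis unfolding Proj_sections_def by (simp add: PiE_iff)
qed

lemma unfrac_add_mult:
  assumes "q \<in> range frac" "r \<in> range frac"
  shows "unfrac (q + r) = unfrac q + unfrac r" "unfrac (q * r) = unfrac q * unfrac r"
  using assms by (auto simp: unfrac_frac frac_add[symmetric] frac_mult[symmetric])

lemma unfrac_one: "unfrac 1 = 1"
  using unfrac_frac[of 1] by (simp add: frac_one)

text \<open>The hypothesis makes \<open>\<theta>\<close> compatible with the structure maps, so that
  the isomorphism is one over the base field.\<close>

lemma Proj_isomorphic:
  assumes "\<And>c. \<theta> (\<iota>' c) = \<iota> c"
  shows "ringed_isomorphic (Proj A G \<iota>) (Proj B H \<iota>')" (is "ringed_isomorphic ?X ?Y")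
proof (rule ringed_isomorphicI[where f = fwd and \<phi> = pull and g = bwd and \<gamma> = push])
  have pX: "points ?X = Proj_points A G" and pY: "points ?Y = Proj_points B H"
    by (simp_all add: points_def Proj_def dom.topspace_Proj_top cod.topspace_Proj_top)
  have preX: "preimg ?X fwd V = {P \<in> Proj_points A G. fwd P \<in> V}" for V
    by (simp add: preimg_def pX)
  have preY: "preimg ?Y bwd U = {Q \<in> Proj_points B H. bwd Q \<in> U}" for U
    by (simp add: preimg_def pY)
  have subX: "U \<subseteq> Proj_points A G" if "openin (Proj_top A G) U" for U
    using openin_subset[OF that] by (simp add: dom.topspace_Proj_top)
  have subY: "V \<subseteq> Proj_points B H" if "openin (Proj_top B H) V" for V
    using openin_subset[OF that] by (simp add: cod.topspace_Proj_top)
  show "bwd (fwd P) = P" if "P \<in> points ?X" for P using that bwd_fwd by (simp add: pX)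
  show "fwd (bwd Q) = Q" if "Q \<in> points ?Y" for Q using that fwd_bwd by (simp add: pY)
  show "presheaf_morphism ?X ?Y fwd pull"
    unfolding presheaf_morphism_def preX
  proof (intro conjI allI impI ballI)
    show "continuous_map (space_top ?X) (space_top ?Y) fwd"
      using continuous_fwd by (simp add: Proj_def)
    show "pull V \<in> ring_hom (sections ?Y V) (sections ?X {P \<in> Proj_points A G. fwd P \<in> V})"
      if "openin (space_top ?Y) V" for V
      using that pull_sections[of V]
      by (intro ring_hom_memI) (auto simp: Proj_def pull_def frac_add frac_mult frac_one fun_eq_iff)
    show "pull W (res ?Y V W s) = res ?X {P \<in> Proj_points A G. fwd P \<in> V}
        {P \<in> Proj_points A G. fwd P \<in> W} (pull V s)" if "W \<subseteq> V" for V W s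
      using that by (auto simp: Proj_def pull_def fun_eq_iff restrict_def)
    show "pull V (scalar ?Y V c) = scalar ?X {P \<in> Proj_points A G. fwd P \<in> V} c" for V c
      by (auto simp: Proj_def pull_def fun_eq_iff frac_Fract assms theta_one)
  qed
  show "presheaf_morphism ?Y ?X bwd push"
    unfolding presheaf_morphism_def preY
  proof (intro conjI allI impI ballI)
    show "continuous_map (space_top ?Y) (space_top ?X) bwd"
      using continuous_bwd by (simp add: Proj_def)
    show "push U \<in> ring_hom (sections ?X U) (sections ?Y {Q \<in> Proj_points B H. bwd Q \<in> U})"
      if "openin (space_top ?X) U" for U
      using that push_sections[of U]
      by (intro ring_hom_memI)
        (auto simp: Proj_def push_def unfrac_add_mult unfrac_one fun_eq_iff section_in_range_frac)
    show "push W (res ?X U W t) = res ?Y {Q \<in> Proj_points B H. bwd Q \<in> U}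
        {Q \<in> Proj_points B H. bwd Q \<in> W} (push U t)" if "W \<subseteq> U" for U W t
      using that by (auto simp: Proj_def push_def fun_eq_iff restrict_def)
    have "unfrac (Fract (\<iota> c) 1) = Fract (\<iota>' c) 1" for c
      using unfrac_frac[of "Fract (\<iota>' c) 1"] by (simp add: frac_Fract assms theta_one)
    then show "push U (scalar ?X U c) = scalar ?Y {Q \<in> Proj_points B H. bwd Q \<in> U} c" for U c
      by (auto simp: Proj_def push_def fun_eq_iff)
  qed
  show "pull (preimg ?Y bwd U) (push U t) = t"
    if U: "openin (space_top ?X) U" and t: "t \<in> carrier (sections ?X U)" for U t
  proof
    have t': "t \<in> Proj_sections A G U" and U': "U \<subseteq> Proj_points A G"
      using U t subX by (simp_all add: Proj_def)
    \<comment> \<open>The functions must agree at every \<open>P\<close>; outside \<open>U\<close>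
      both are \<open>undefined\<close>, as sections are extensional.\<close>
    fix P show "pull (preimg ?Y bwd U) (push U t) P = t P"
    proof (cases "P \<in> U")
      case True
      then have P: "P \<in> Proj_points A G" using U' by blast
      then have "t P \<in> range frac"
        using section_in_range_frac[OF t' fwd_points[OF P]] True by (simp add: bwd_fwd)
      then show ?thesis
        using True P by (simp add: pull_def push_def preY fwd_points bwd_fwd frac_unfrac)
    next
      case False
      then have "t P = undefined"
        using t' by (auto simp: Proj_sections_def PiE_iff extensional_def)
      then show ?thesis using False by (auto simp: pull_def preY bwd_fwd)
    qed
  qed
  show "push (preimg ?X fwd V) (pull V s) = s"
    if V: "openin (space_top ?Y) V" and s: "s \<in> carrier (sections ?Y V)" for V s
  proof
    have s': "s \<in> Proj_sections B H V" and V': "V \<subseteq> Proj_points B H"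
      using V s subY by (simp_all add: Proj_def)
    fix Q show "push (preimg ?X fwd V) (pull V s) Q = s Q"
    proof (cases "Q \<in> V")
      case True
      then have "Q \<in> Proj_points B H" using V' by blast
      then show ?thesis
        using True by (simp add: pull_def push_def preX bwd_points fwd_bwd unfrac_frac)
    next
      case False
      then have "s Q = undefined"
        using s' by (auto simp: Proj_sections_def PiE_iff extensional_def)
      then show ?thesis using False by (auto simp: push_def preX fwd_bwd)
    qed
  qed
qed

end


section \<open>Substituting powers of the variables\<close>

definition scale_exps :: "(nat \<Rightarrow> nat) \<Rightarrow> (nat \<Rightarrow>\<^sub>0 nat) \<Rightarrow> nat \<Rightarrow>\<^sub>0 nat" where
  "scale_exps d m = Poly_Mapping.mapp (\<lambda>i e. d i * e) m"

lemma lookup_scale_exps: "Poly_Mapping.lookup (scale_exps d m) i = d i * Poly_Mapping.lookup m i"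
  by (auto simp: scale_exps_def lookup_mapp when_def in_keys_iff)

lemma scale_exps_zero: "scale_exps d 0 = 0"
  by (rule poly_mapping_eqI) (simp add: lookup_scale_exps)

lemma scale_exps_add: "scale_exps d (l + m) = scale_exps d l + scale_exps d m"
  by (rule poly_mapping_eqI) (simp add: lookup_scale_exps lookup_add algebra_simps)

lemma inj_scale_exps:
  assumes "\<And>i. 0 < d i" shows "inj (scale_exps d)"
proof (rule injI)
  fix l m assume eq: "scale_exps d l = scale_exps d m"
  show "l = m"
  proof (rule poly_mapping_eqI)
    fix i
    have "d i * Poly_Mapping.lookup l i = d i * Poly_Mapping.lookup m i"
      by (metis eq lookup_scale_exps)
    then show "Poly_Mapping.lookup l i = Poly_Mapping.lookup m i" using assms[of i] by simp
  qed
qed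

lemma keys_scale_exps:
  assumes "\<And>i. 0 < d i" shows "Poly_Mapping.keys (scale_exps d m) = Poly_Mapping.keys m"
  using assms by (auto simp: in_keys_iff lookup_scale_exps)

section \<open>Relabelling the exponents of polynomials\<close>

definition map_exps :: "('m \<Rightarrow> 'n) \<Rightarrow> ('m \<Rightarrow>\<^sub>0 'k) \<Rightarrow> 'n \<Rightarrow>\<^sub>0 'k::comm_monoid_add" where
  "map_exps f p = (\<Sum>m\<in>Poly_Mapping.keys p. Poly_Mapping.single (f m) (Poly_Mapping.lookup p m))"

lemma lookup_map_exps:
  assumes "inj f"
  shows "Poly_Mapping.lookup (map_exps f p) (f m) = Poly_Mapping.lookup p m"
proof -
  have "Poly_Mapping.lookup (map_exps f p) (f m) =
      (\<Sum>l\<in>Poly_Mapping.keys p. if l = m then Poly_Mapping.lookup p l else 0)"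
    unfolding map_exps_def lookup_sum
    by (rule sum.cong) (auto simp: lookup_single when_def inj_eq[OF assms])
  then show ?thesis by (simp add: in_keys_iff)
qed

lemma lookup_map_exps_outside:
  "k \<notin> range f \<Longrightarrow> Poly_Mapping.lookup (map_exps f p) k = 0"
  unfolding map_exps_def lookup_sum by (rule sum.neutral) (auto simp: lookup_single when_def)

lemma keys_map_exps:
  assumes "inj f" shows "Poly_Mapping.keys (map_exps f p) = f ` Poly_Mapping.keys p"
proof (rule Set.set_eqI)
  fix k show "k \<in> Poly_Mapping.keys (map_exps f p) \<longleftrightarrow> k \<in> f ` Poly_Mapping.keys p"
    by (cases "k \<in> range f")
      (auto simp: in_keys_iff lookup_map_exps[OF assms] lookup_map_exps_outside inj_eq[OF assms])
qed

lemma map_exps_eqI: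
  assumes "inj f" "\<And>m. Poly_Mapping.lookup q (f m) = Poly_Mapping.lookup p m"
    and "\<And>k. k \<notin> range f \<Longrightarrow> Poly_Mapping.lookup q k = 0"
  shows "map_exps f p = q"
proof (rule poly_mapping_eqI)
  fix k show "Poly_Mapping.lookup (map_exps f p) k = Poly_Mapping.lookup q k"
    using assms by (cases "k \<in> range f") (auto simp: lookup_map_exps lookup_map_exps_outside)
qed

lemma map_exps_add:
  assumes "inj f" shows "map_exps f (p + q) = map_exps f p + map_exps f q"
  by (rule map_exps_eqI[OF assms])
    (simp_all add: lookup_add lookup_map_exps[OF assms] lookup_map_exps_outside)

lemma map_exps_sum:
  assumes "inj f" shows "map_exps f (sum p I) = (\<Sum>i\<in>I. map_exps f (p i))"
  by (induction I rule: infinite_finite_induct)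
    (simp_all add: map_exps_add[OF assms], simp_all add: map_exps_def)

lemma map_exps_single: "map_exps f (Poly_Mapping.single m c) = Poly_Mapping.single (f m) c"
  by (cases "c = 0") (simp_all add: map_exps_def)

lemma poly_mapping_sum_single:
  "(\<Sum>m\<in>Poly_Mapping.keys p. Poly_Mapping.single m (Poly_Mapping.lookup p m)) = p"
  by (rule poly_mapping_eqI) (simp add: lookup_sum lookup_single when_def in_keys_iff)

text \<open>Both factors are expanded into monomials, where the claim is the additivity of
  \<open>f\<close> on exponents.\<close>

lemma map_exps_mult:
  fixes p q :: "'m::monoid_add \<Rightarrow>\<^sub>0 'k::semiring_0" and f :: "'m \<Rightarrow> 'n::monoid_add"
  assumes "inj f" "\<And>l m. f (l + m) = f l + f m"
  shows "map_exps f (p * q) = map_exps f p * map_exps f q"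
proof -
  have "p * q = (\<Sum>l\<in>Poly_Mapping.keys p. \<Sum>m\<in>Poly_Mapping.keys q.
      Poly_Mapping.single (l + m) (Poly_Mapping.lookup p l * Poly_Mapping.lookup q m))"
    unfolding mult_single[symmetric] sum_product[symmetric] poly_mapping_sum_single ..
  then have "map_exps f (p * q) = (\<Sum>l\<in>Poly_Mapping.keys p. \<Sum>m\<in>Poly_Mapping.keys q.
      Poly_Mapping.single (f l + f m) (Poly_Mapping.lookup p l * Poly_Mapping.lookup q m))"
    by (simp add: map_exps_sum[OF assms(1)] map_exps_single assms(2))
  also have "\<dots> = map_exps f p * map_exps f q"
    unfolding map_exps_def mult_single[symmetric] sum_product ..
  finally show ?thesis .
qed

text \<open>\<open>x\<^sub>i ^ d i\<close> has degree \<open>d i * a i\<close> for the weight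
  \<open>a\<close>, which the hypothesis makes \<open>N\<close> times the degree of
  \<open>x\<^sub>i\<close> for \<open>a'\<close>.\<close>

lemma weighted_degree_scale_exps:
  assumes "\<And>i. i \<le> n \<Longrightarrow> d i * a i = N * a' i"
  shows "weighted_degree n a (scale_exps d m) = N * weighted_degree n a' m"
proof -
  have "a i * (d i * Poly_Mapping.lookup m i) = N * (a' i * Poly_Mapping.lookup m i)" if "i \<le> n" for i
    using assms[OF that] by (metis mult.assoc mult.commute)
  then show ?thesis
    unfolding weighted_degree_def lookup_scale_exps sum_distrib_left by (intro sum.cong) auto
qed

text \<open>\<open>map_exps (scale_exps d)\<close> is the substitution \<open>x\<^sub>i \<mapsto> x\<^sub>i ^ d i\<close>.\<close>

lemma veronese_weighted:
  fixes a a' d :: "nat \<Rightarrow> nat"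
  assumes N: "0 < N" and d: "\<And>i. 0 < d i" and a': "\<And>i. i \<le> n \<Longrightarrow> d i * a i = N * a' i"
    and dvd: "\<And>m i. \<lbrakk>N dvd (\<Sum>i\<le>n. a i * m i); i \<le> n\<rbrakk> \<Longrightarrow> d i dvd m i"
  shows "veronese (poly_ring n :: 'k::field mpoly set) (weighted_piece n a)
    (poly_ring n) (weighted_piece n a') (map_exps (scale_exps d)) N"
proof -
  let ?s = "scale_exps d"
  have inj: "inj ?s" using d by (rule inj_scale_exps)
  have "map_exps ?s ` weighted_piece n a' e = (weighted_piece n a (N * e) :: 'k mpoly set)" for e
  proof (intro equalityI subsetI)
    fix p :: "'k mpoly" assume "p \<in> map_exps ?s ` weighted_piece n a' e"
    then show "p \<in> weighted_piece n a (N * e)"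
      by (force simp: weighted_piece_def poly_ring_def keys_map_exps[OF inj] keys_scale_exps[OF d]
          weighted_degree_scale_exps[OF a'])
  next
    fix p :: "'k mpoly" assume p: "p \<in> weighted_piece n a (N * e)"
    \<comment> \<open>\<open>q\<close> reads the coefficients of \<open>p\<close> along
      \<open>?s\<close>; it is a preimage of \<open>p\<close> once all monomials of \<open>p\<close>
      are known to lie in the range of \<open>?s\<close>.\<close>
    define q where "q = Poly_Mapping.map_key ?s p"
    have lookup_q: "Poly_Mapping.lookup q m = Poly_Mapping.lookup p (?s m)" for m
      by (simp add: q_def map_key.rep_eq[OF inj])
    have "k \<in> range ?s" if k: "k \<in> Poly_Mapping.keys p" for k
    proof -
      have kn: "Poly_Mapping.keys k \<subseteq> {..n}" and deg: "weighted_degree n a k = N * e"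
        using p k by (auto simp: weighted_piece_def poly_ring_def)
      \<comment> \<open>\<open>dvd\<close> handles the variables up to \<open>n\<close>; all other
        exponents are 0.\<close>
      have "d i dvd Poly_Mapping.lookup k i" for i
      proof (cases "i \<le> n")
        case True
        then show ?thesis using dvd[of "Poly_Mapping.lookup k" i] deg by (simp add: weighted_degree_def)
      next
        case False
        then have "Poly_Mapping.lookup k i = 0" using kn by (metis atMost_iff in_keys_iff subsetD)
        then show ?thesis by simp
      qed
      then have "Poly_Mapping.lookup k i =
          Poly_Mapping.lookup (?s (Poly_Mapping.mapp (\<lambda>i e. e div d i) k)) i" for i
        by (simp add: lookup_scale_exps lookup_mapp when_def in_keys_iff)
      then have "k = ?s (Poly_Mapping.mapp (\<lambda>i e. e div d i) k)"
        by (rule poly_mapping_eqI)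
      then show ?thesis by blast
    qed
    then have "Poly_Mapping.lookup p k = 0" if "k \<notin> range ?s" for k
      using that by (metis in_keys_iff)
    then have "map_exps ?s q = p"
      using lookup_q by (intro map_exps_eqI[OF inj]) auto
    moreover have "Poly_Mapping.keys m \<subseteq> {..n} \<and> weighted_degree n a' m = e"
      if m: "m \<in> Poly_Mapping.keys q" for m
    proof -
      have "?s m \<in> Poly_Mapping.keys p" using m by (simp add: in_keys_iff lookup_q)
      then have "Poly_Mapping.keys (?s m) \<subseteq> {..n}" "weighted_degree n a (?s m) = N * e"
        using p by (auto simp: weighted_piece_def poly_ring_def)
      then show ?thesis
        using N by (simp add: keys_scale_exps[OF d] weighted_degree_scale_exps[OF a'])
    qed
    then have "q \<in> weighted_piece n a' e" by (simp add: weighted_piece_def poly_ring_def)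
    ultimately show "p \<in> map_exps ?s ` weighted_piece n a' e" by blast
  qed
  moreover have "inj (map_exps ?s :: 'k mpoly \<Rightarrow> 'k mpoly)"
  proof (rule injI, rule poly_mapping_eqI)
    fix p q :: "'k mpoly" and m
    assume "map_exps ?s p = map_exps ?s q"
    then show "Poly_Mapping.lookup p m = Poly_Mapping.lookup q m"
      using lookup_map_exps[OF inj, where p = p and m = m]
        lookup_map_exps[OF inj, where p = q and m = m] by simp
  qed
  moreover have "map_exps ?s (1 :: 'k mpoly) = 1"
    using map_exps_single[of ?s 0 "1::'k"] by (simp add: scale_exps_zero)
  ultimately show ?thesis
    using N by (intro veronese.intro veronese_axioms.intro graded_domain_weighted)
      (simp_all add: map_exps_add[OF inj] map_exps_mult[OF inj scale_exps_add])
qed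


section \<open>Well-formed weights\<close>

lemma prod_dvd_of_pairwise_coprime:
  fixes f :: "'i \<Rightarrow> nat"
  assumes "finite I" "\<And>i. i \<in> I \<Longrightarrow> f i dvd c"
    and "\<And>i j. \<lbrakk>i \<in> I; j \<in> I; i \<noteq> j\<rbrakk> \<Longrightarrow> coprime (f i) (f j)"
  shows "prod f I dvd c"
  using assms
proof (induction I)
  case (insert i I)
  then have "coprime (f i) (prod f I)" by (intro prod_coprime_right) auto
  then show ?case using insert by (simp add: divides_mult)
qed simp

text \<open>The conclusions after well-formedness are the hypotheses of
  \<open>veronese_weighted\<close>, so all arithmetic of weights is confined to this lemma.\<close>

lemma exists_well_formed_veronese_weight:
  fixes a :: "nat \<Rightarrow> nat"
  assumes n: "n \<ge> 1" and a: "positive_weight n a"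
  obtains a' N d where "positive_weight n a'" "well_formed_weight n a'" "0 < N" "\<And>i. 0 < d i"
    "\<And>i. i \<le> n \<Longrightarrow> d i * a i = N * a' i"
    "\<And>m i. \<lbrakk>N dvd (\<Sum>i\<le>n. a i * m i); i \<le> n\<rbrakk> \<Longrightarrow> d i dvd m i"
proof -
  define g where "g = Gcd (a ` {..n})"
  define b where "b i = a i div g" for i
  \<comment> \<open>The default 1 beyond \<open>n\<close> makes \<open>d\<close> positive
    everywhere, as \<open>inj_scale_exps\<close> requires.\<close>
  define d where "d i = (if i \<le> n then Gcd (b ` ({..n} - {i})) else 1)" for i
  define D where "D = prod d {..n}"
  define a' where "a' i = b i * d i div D" for i
  have a_pos: "0 < a i" if "i \<le> n" for i using a that by (simp add: positive_weight_def)
  have ab: "a i = g * b i" if "i \<le> n" for i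
    using that by (simp add: b_def g_def)
  have g_pos: "0 < g" and b_pos: "0 < b i" if "i \<le> n" for i
    using ab[OF that] a_pos[OF that] by (auto intro: gr0I)
  have g: "0 < g" using g_pos[of 0] by simp
  \<comment> \<open>If \<open>k\<close> divides every \<open>b i\<close>, then \<open>g * k\<close>
    divides every \<open>a i\<close>, hence their gcd \<open>g\<close>.\<close>
  have b_gcd: "k = 1" if "\<And>i. i \<le> n \<Longrightarrow> k dvd b i" for k
  proof -
    have "\<forall>x\<in>a ` {..n}. g * k dvd x" using that ab by auto
    then have "g * k dvd g" unfolding dvd_Gcd_iff[symmetric] g_def[symmetric] .
    then show ?thesis using g by auto
  qed
  have d_dvd: "d i dvd b j" if "i \<le> n" "j \<le> n" "i \<noteq> j" for i j
    using that by (auto simp: d_def)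
  have d_pos: "0 < d i" for i
  proof (cases "i \<le> n")
    case True
    \<comment> \<open>Some index other than \<open>i\<close>, available because
      \<open>n \<ge> 1\<close>; otherwise \<open>d i\<close> would be the gcd of the empty set,
      which is 0.\<close>
    define j :: nat where "j = (if i = 0 then 1 else 0)"
    have "j \<le> n" "i \<noteq> j" using n by (auto simp: j_def)
    then show ?thesis using d_dvd[OF True] b_pos[of j] by (auto intro: gr0I)
  qed (simp add: d_def)
  \<comment> \<open>A common divisor divides every \<open>b l\<close>: through \<open>d i\<close>
    for \<open>l \<noteq> i\<close> and through \<open>d j\<close> for \<open>l = i\<close>.\<close>
  have d_coprime: "coprime (d i) (d j)" if ij: "i \<le> n" "j \<le> n" "i \<noteq> j" for i j
  proof (rule coprimeI)
    fix k assume k: "k dvd d i" "k dvd d j"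
    have "k dvd b l" if "l \<le> n" for l
      using d_dvd[of i l] d_dvd[of j l] k ij that by (cases "l = i") (auto intro: dvd_trans)
    then show "is_unit k" using b_gcd by simp
  qed
  have bd_coprime: "coprime (d i) (b i)" if i: "i \<le> n" for i
  proof (rule coprimeI)
    fix k assume k: "k dvd d i" "k dvd b i"
    have "k dvd b l" if "l \<le> n" for l
      using d_dvd[of i l] k i that by (cases "l = i") (auto intro: dvd_trans)
    then show "is_unit k" using b_gcd by simp
  qed
  have D_pos: "0 < D" using d_pos by (simp add: D_def)
  have D_split: "D = d i * prod d ({..n} - {i})" if "i \<le> n" for i
    unfolding D_def using that by (intro prod.remove) auto
  \<comment> \<open>Each \<open>d j\<close> with \<open>j \<noteq> i\<close> divides
    \<open>b i\<close>, and these are pairwise coprime. Multiplying by \<open>d i\<close> shows that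
    the division by \<open>D\<close> in \<open>a'\<close> is exact.\<close>
  have "prod d ({..n} - {i}) dvd b i" if "i \<le> n" for i
    using that by (intro prod_dvd_of_pairwise_coprime d_dvd d_coprime) auto
  then have "D dvd b i * d i" if "i \<le> n" for i
    using that unfolding D_split[OF that] by (simp add: mult.commute mult_dvd_mono)
  then have bd: "b i * d i = D * a' i" if "i \<le> n" for i
    using that by (simp add: a'_def)
  have "positive_weight n a'"
    unfolding positive_weight_def using bd b_pos d_pos by (metis gr0I mult_is_0 not_gr0)
  moreover have "well_formed_weight n a'"
    unfolding well_formed_weight_def
  proof (intro allI impI)
    fix i assume i: "i \<le> n"
    define k where "k = Gcd {a' j | j. j \<le> n \<and> j \<noteq> i}"
    \<comment> \<open>Cancelling \<open>d j\<close> in \<open>b j * d j = D * a' j\<close> leaves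
      \<open>d i\<close> and \<open>a' j\<close> as factors of \<open>b j\<close>. So
      \<open>d i * k\<close> divides the gcd of these \<open>b j\<close>, which is
      \<open>d i\<close>, forcing \<open>k = 1\<close>.\<close>
    have "d i * k dvd b j" if j: "j \<le> n" "j \<noteq> i" for j
    proof -
      have "prod d ({..n} - {i}) = d j * prod d ({..n} - {i} - {j})"
        using j by (intro prod.remove) auto
      then have "d j * b j = d j * (d i * a' j * prod d ({..n} - {i} - {j}))"
        using bd[OF j(1)] D_split[OF i] by (simp add: algebra_simps)
      then have "b j = d i * a' j * prod d ({..n} - {i} - {j})" using d_pos[of j] by simp
      moreover have "k dvd a' j" unfolding k_def using j by (intro Gcd_dvd) blast
      ultimately show ?thesis by (simp add: mult_dvd_mono dvd_mult2)
    qed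
    then have "d i * k dvd d i"
      using i by (subst (2) d_def) (auto simp: dvd_Gcd_iff)
    then show "k = 1" using d_pos[of i] by auto
  qed
  moreover have "0 < g * D" using g D_pos by simp
  moreover have "d i * a i = g * D * a' i" if "i \<le> n" for i
    using bd[OF that] ab[OF that] by (metis mult.assoc mult.commute)
  \<comment> \<open>Modulo \<open>d i\<close> all terms except \<open>b i * m i\<close> vanish, and
    \<open>b i\<close> is coprime to \<open>d i\<close>.\<close>
  moreover have "d i dvd m i" if N: "g * D dvd (\<Sum>i\<le>n. a i * m i)" and i: "i \<le> n" for m i
  proof -
    have "(\<Sum>i\<le>n. a i * m i) = g * (\<Sum>i\<le>n. b i * m i)"
      by (simp add: ab sum_distrib_left mult.assoc)
    then have "D dvd (\<Sum>i\<le>n. b i * m i)" using N g by simp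
    then have "d i dvd (\<Sum>i\<le>n. b i * m i)" using D_split[OF i] by (metis dvd_mult_left)
    also have "(\<Sum>i\<le>n. b i * m i) = b i * m i + (\<Sum>j\<in>{..n} - {i}. b j * m j)"
      using i by (intro sum.remove) auto
    finally have "d i dvd b i * m i + (\<Sum>j\<in>{..n} - {i}. b j * m j)" .
    moreover have "d i dvd (\<Sum>j\<in>{..n} - {i}. b j * m j)"
      using d_dvd[OF i] by (intro dvd_sum dvd_mult2) auto
    ultimately have "d i dvd b i * m i" using dvd_add_left_iff by blast
    then show ?thesis using bd_coprime[OF i] coprime_dvd_mult_right_iff by blast
  qed
  ultimately show thesis using that[of a' "g * D" d] d_pos by blast
qed

theorem theorem4p3p6:
  fixes n :: nat and a :: "nat \<Rightarrow> nat"
  assumes "n \<ge> 1" and "positive_weight n a"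
  shows "\<exists>a'. positive_weight n a' \<and> well_formed_weight n a' \<and>
    ringed_isomorphic
      (weighted_projective_space TYPE('k::alg_closed_field) n a)
      (weighted_projective_space TYPE('k) n a')"
proof -
  obtain a' N d where a': "positive_weight n a'" "well_formed_weight n a'"
    and v: "0 < N" "\<And>i. 0 < d i" "\<And>i. i \<le> n \<Longrightarrow> d i * a i = N * a' i"
      "\<And>m i. \<lbrakk>N dvd (\<Sum>i\<le>n. a i * m i); i \<le> n\<rbrakk> \<Longrightarrow> d i dvd m i"
    by (rule exists_well_formed_veronese_weight[OF assms], rule that)
  interpret veronese "poly_ring n :: 'k mpoly set" "weighted_piece n a"
    "poly_ring n" "weighted_piece n a'" "map_exps (scale_exps d)" N
    using v by (rule veronese_weighted)
  \<comment> \<open>The substitution fixes constants, whose exponent vector is 0, so it respects the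
    scalars.\<close>
  have "ringed_isomorphic (weighted_projective_space TYPE('k) n a)
      (weighted_projective_space TYPE('k) n a')"
    unfolding weighted_projective_space_def
    by (rule Proj_isomorphic) (simp add: map_exps_single scale_exps_zero)
  then show ?thesis using a' by blast
qed

end
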